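(* Let $(N, C_1, C_2, \dots)$ be a nonnegative random vector, where $N \in \{0,1,2,\dots\} \cup \{\infty\}$, and let $\alpha>0$. Suppose that there exists $j \geq 1$ with $P(N\ge j,\,C_j>0)>0$ such that the measure $P(\log C_j\in du,\, C_j > 0,\, N\ge j)$ is nonarithmetic. Assume further that $$0 < E\left[ \sum_{j=1}^N C_j^\alpha \log C_j \right] < \infty, \qquad E\left[ \sum_{j=1}^N C_j^\alpha \right] = 1, \qquad E\left[ \sum_{j=1}^N C_j^\gamma \right] < \infty \ \text{ for some } 0 \leq \gamma < \alpha,$$ and that the random variable $R$ is independent of $(N, C_1, C_2, \dots)$ with $E[R^\beta] < \infty$ for any $0< \beta < \alpha$. If $$\int_0^\infty \left| P(R > t) - E\left[ \sum_{j=1}^N 1 (C_j R > t ) \right] \right| t^{\alpha-1}\, dt < \infty,$$ then $$P(R > t) \sim H t^{-\alpha}, \qquad t \to \infty,$$ where $0 \leq H < \infty$ is given by $$H = \frac{1}{E\left[ \sum_{j=1}^N C_j^\alpha \log C_j \right] } \int_{0}^\infty v^{\alpha-1} \left( P(R > v) - E\left[ \sum_{j=1}^{N} 1(C_{j} R > v ) \right] \right) dv .$$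
   Context: $1(\cdot)$ denotes the indicator function. Convention: $0^\alpha \log 0 = 0$ for all $\alpha>0$. When $N=\infty$, $\sum_{j=1}^N$ is an infinite series. A measure on $\mathbb{R}$ is nonarithmetic if it is not concentrated on $d\mathbb{Z}$ for any $d>0$. The notation $g(x)\sim f(x)$ as $x\to\infty$ means $\lim_{x\to\infty} g(x)/f(x)=1$. *)

theory Defs
  imports "HOL-Probability.Probability" "HOL-Library.Landau_Symbols"
begin

unbundle asymp_equiv_syntax

text \<open>
  The weights are indexed from 1; \<open>C 0\<close> is never used.  Below, a sum over \<open>1 \<le> j \<le> N\<close> is a series
  over \<open>nat\<close> cut off by the indicator of \<open>branches N\<close>, so that \<open>N = \<infinity>\<close> gives the full series.
\<close>

definition branches :: "enat \<Rightarrow> nat set" where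
  "branches n = {j. 1 \<le> j \<and> enat j \<le> n}"

definition nonarithmetic :: "real measure \<Rightarrow> bool" where
  "nonarithmetic \<mu> \<longleftrightarrow> (\<forall>d>0. emeasure \<mu> (UNIV - range (\<lambda>k::int. d * of_int k)) \<noteq> 0)"

text \<open>The measure \<open>P(log C\<^sub>j \<in> du, C\<^sub>j > 0, N \<ge> j)\<close>; in general it is not a probability measure.\<close>

definition log_weight_measure ::
    "'a measure \<Rightarrow> ('a \<Rightarrow> enat) \<Rightarrow> (nat \<Rightarrow> 'a \<Rightarrow> real) \<Rightarrow> nat \<Rightarrow> real measure" where
  "log_weight_measure M N C j =
     distr (restrict_space M {\<omega> \<in> space M. C j \<omega> > 0 \<and> N \<omega> \<ge> enat j}) borel (\<lambda>\<omega>. ln (C j \<omega>))"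

text \<open>
  \<open>E[\<Sum>\<^sub>j C\<^sub>j\<^sup>s]\<close>, possibly infinite.  As \<open>0 powr 0 = 0\<close>, for \<open>s = 0\<close> this is the mean number of
  positive weights; it is at most \<open>E[N]\<close>, which the convention \<open>0\<^sup>0 = 1\<close> would give.
\<close>

definition weight_moment ::
    "'a measure \<Rightarrow> ('a \<Rightarrow> enat) \<Rightarrow> (nat \<Rightarrow> 'a \<Rightarrow> real) \<Rightarrow> real \<Rightarrow> ennreal" where
  "weight_moment M N C s =
     (\<integral>\<^sup>+\<omega>. (\<Sum>j. ennreal (C j \<omega> powr s) * indicator (branches (N \<omega>)) j) \<partial>M)"

text \<open>The random variable \<open>\<Sum>\<^sub>j C\<^sub>j\<^sup>\<alpha> log C\<^sub>j\<close>; a weight \<open>0\<close> contributes \<open>0\<close> because \<open>0 powr \<alpha> = 0\<close>.\<close>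

definition log_weight_sum ::
    "('a \<Rightarrow> enat) \<Rightarrow> (nat \<Rightarrow> 'a \<Rightarrow> real) \<Rightarrow> real \<Rightarrow> 'a \<Rightarrow> real" where
  "log_weight_sum N C \<alpha> \<omega> =
     (\<Sum>j. C j \<omega> powr \<alpha> * ln (C j \<omega>) * indicator (branches (N \<omega>)) j)"

text \<open>
  \<open>E[\<Sum>\<^sub>j 1(C\<^sub>j R > t)]\<close> as a real number.  If \<open>E[\<Sum>\<^sub>j C\<^sub>j\<^sup>s]\<close> and \<open>E[R\<^sup>s]\<close> are finite for some \<open>s > 0\<close>
  and \<open>R\<close> is independent of the weights, the expectation is finite for every \<open>t > 0\<close> by Markov's
  inequality, so \<open>enn2real\<close> loses nothing there.
\<close>

definition expected_exceedances ::
    "'a measure \<Rightarrow> ('a \<Rightarrow> enat) \<Rightarrow> (nat \<Rightarrow> 'a \<Rightarrow> real) \<Rightarrow> ('a \<Rightarrow> real) \<Rightarrow> real \<Rightarrow> real" where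
  "expected_exceedances M N C R t =
     enn2real (\<integral>\<^sup>+\<omega>. (\<Sum>j. indicator {t<..} (C j \<omega> * R \<omega>) * indicator (branches (N \<omega>)) j) \<partial>M)"

end

theory Submission
  imports Defs
begin

text \<open>
  Write \<open>r(t) = e\<^bsup>\<alpha>t\<^esup> P(R > e\<^sup>t)\<close>; the claim is that \<open>r\<close> converges to \<open>H\<close> at infinity.  The tilted measure
  \<open>\<eta>(A) = E[\<Sum>\<^sub>j C\<^sub>j\<^sup>\<alpha> 1(log C\<^sub>j \<in> A)]\<close> is a probability measure because the weights have total
  \<open>\<alpha>\<close>-moment 1, its mean is \<open>\<mu> = E[\<Sum>\<^sub>j C\<^sub>j\<^sup>\<alpha> log C\<^sub>j]\<close>, and conditioning on the weights gives
  \<open>e\<^bsup>\<alpha>t\<^esup> E[\<Sum>\<^sub>j 1(C\<^sub>j R > e\<^sup>t)] = (r * \<eta>)(t)\<close>.  Hence \<open>r = g + r * \<eta>\<close>, where \<open>g\<close> is, after the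
  substitution \<open>v = e\<^sup>t\<close>, the integrand of \<open>H\<close>; the hypothesis says that \<open>g\<close> is integrable, and
  \<open>H = \<integral>g / \<mu>\<close>.  So the theorem is a two-sided renewal theorem for an integrable, not directly Riemann
  integrable, \<open>g\<close>; the missing regularity comes from the monotonicity of the tail, that is, from
  \<open>r(t + s) \<le> e\<^bsup>\<alpha>s\<^esup> r(t)\<close> for \<open>s \<ge> 0\<close>.

  \<^item> \<open>r\<close> is bounded.  Positive drift and the moment of order \<open>\<gamma> < \<alpha>\<close> give \<open>\<integral>e\<^bsup>-\<epsilon>u\<^esup> d\<eta> < 1\<close> for a small
    \<open>\<epsilon> > 0\<close> (\<open>exists_exponential_moment_less_1\<close>), so the expected number of visits of the random walk
    to a unit interval is bounded (\<open>renewal_of_unit_interval_le\<close>).  By duality \<open>\<integral>r\<close> over a unit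
    interval is at most a constant times \<open>\<integral>|g|\<close> (\<open>unit_interval_integral_le\<close>).

  \<^item> \<open>r\<close> is slowly varying in the additive sense: \<open>r(t - a) - r(t) \<longlongrightarrow> 0\<close> for every \<open>a\<close>.  The integral
    \<open>\<phi>\<close> of \<open>r\<close> over a sliding window is Lipschitz and satisfies \<open>\<phi> - \<phi> * \<eta> \<longlongrightarrow> 0\<close>.  An asymptotic form
    of the Choquet-Deny theorem (\<open>lipschitz_increments_tendsto_0\<close>) yields \<open>\<phi>(t - a) - \<phi>(t) \<longlongrightarrow> 0\<close>, and the
    growth condition transfers this from \<open>\<phi>\<close> to \<open>r\<close> (\<open>r_increments_tendsto_0\<close>).

  \<^item> The limit is found by integrating the equation: with \<open>\<Psi>(T) = \<integral>\<^bsub>-\<infinity>\<^esub>\<^sup>T r\<close> one has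
    \<open>\<integral>(\<Psi>(T) - \<Psi>(T - u)) \<eta>(du) = \<integral>\<^bsub>-\<infinity>\<^esub>\<^sup>T g\<close> (\<open>cum_balance\<close>).  By slow variation the inner difference is
    \<open>u r(T) + o(1)\<close>, so dominated convergence gives \<open>\<mu> r(T) \<longlongrightarrow> \<integral>g\<close> (\<open>renewal_limit\<close>).
\<close>

section \<open>Subgroups of the real line\<close>

lemma subgroup_multiple:
  fixes G :: "real set"
  assumes "0 \<in> G" and diff: "\<And>x y. x \<in> G \<Longrightarrow> y \<in> G \<Longrightarrow> x - y \<in> G" and d: "d \<in> G"
  shows "d * of_int k \<in> G"
proof (induction k rule: int_induct[where k=0])
  case base then show ?case using \<open>0 \<in> G\<close> by simp
next
  case (step1 i)
  have "0 - d \<in> G" using assms by blast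
  from diff[OF step1(2) this] show ?case by (simp add: algebra_simps)
next
  case (step2 i)
  then show ?case using diff[OF step2(2) d] by (simp add: algebra_simps)
qed

text \<open>
The infimum of the positive elements is attained, since distinct elements are at least \<open>d0\<close> apart,
and division with remainder by it leaves no positive remainder in the group.
\<close>

lemma subgroup_without_small_elements:
  fixes G :: "real set"
  assumes "0 \<in> G" and diff: "\<And>x y. x \<in> G \<Longrightarrow> y \<in> G \<Longrightarrow> x - y \<in> G"
    and "d0 > 0" and gap: "\<And>x. x \<in> G \<Longrightarrow> 0 < x \<Longrightarrow> d0 \<le> x"
  shows "\<exists>d>0. G \<subseteq> range (\<lambda>k::int. d * of_int k)"
proof (cases "\<exists>x\<in>G. x > 0")
  case False
  have "x = 0" if "x \<in> G" for x
    using False that diff[OF \<open>0 \<in> G\<close> that] by (metis diff_0 linorder_neqE_linordered_idom neg_0_less_iff_less)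
  then have "G \<subseteq> range (\<lambda>k::int. 1 * of_int k)" by (auto intro!: image_eqI[of _ _ 0])
  then show ?thesis by (intro exI[of _ 1]) auto
next
  case True
  define P where "P = {x \<in> G. x > 0}"
  define d where "d = Inf P"
  have ne: "P \<noteq> {}" using True by (auto simp: P_def)
  have bdd: "bdd_below P" by (auto simp: P_def bdd_below_def intro!: exI[of _ 0])
  have "d0 \<le> d" unfolding d_def using ne gap by (intro cInf_greatest) (auto simp: P_def)
  then have "d > 0" using \<open>d0 > 0\<close> by simp
  have low: "d \<le> x" if "x \<in> G" "x > 0" for x
    unfolding d_def using that bdd by (intro cInf_lower) (auto simp: P_def)
  have "d \<in> G"
  proof (rule ccontr)
    assume "d \<notin> G"
    obtain x where x: "x \<in> P" "x < d + d0"
      using cInf_lessD[OF ne, of "d + d0"] \<open>d0 > 0\<close> by (auto simp: d_def)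
    have "d < x" using x low[of x] \<open>d \<notin> G\<close> by (cases "d = x") (auto simp: P_def)
    then obtain y where y: "y \<in> P" "y < x"
      using cInf_lessD[OF ne, of x] by (auto simp: d_def)
    have "x - y \<in> G" "x - y > 0" using x y diff by (auto simp: P_def)
    then have "d0 \<le> x - y" by (rule gap)
    moreover have "d \<le> y" using y low by (auto simp: P_def)
    ultimately show False using x by simp
  qed
  have mult: "d * of_int k \<in> G" for k :: int
    by (rule subgroup_multiple) (use assms \<open>d \<in> G\<close> in auto)
  have "x \<in> range (\<lambda>k::int. d * of_int k)" if "x \<in> G" for x
  proof -
    define y where "y = x - d * of_int \<lfloor>x / d\<rfloor>"
    have "y \<in> G" unfolding y_def by (intro diff that mult)
    moreover have "0 \<le> y" "y < d"
      unfolding y_def using \<open>d > 0\<close> floor_divide_lower[of d x] floor_divide_upper[of d x]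
      by (auto simp: algebra_simps)
    ultimately have "y = 0" using low[of y] by force
    then show ?thesis by (auto simp: y_def)
  qed
  then show ?thesis using \<open>d > 0\<close> by auto
qed

lemma shift_at_top: "filterlim (\<lambda>t. t + c) at_top at_top" for c :: real
  using filterlim_tendsto_add_at_top[OF tendsto_const[of c] filterlim_ident]
  by (simp add: add.commute)

section \<open>Asymptotically harmonic functions\<close>

definition (in real_distribution) shift_mean :: "(real \<Rightarrow> real) \<Rightarrow> real \<Rightarrow> real" where
  "shift_mean f t = (\<integral>u. f (t - u) \<partial>M)"

text \<open>
Boundedness is included so that the class is preserved when one averages over a random shift, by
dominated convergence.
\<close>

definition vanishing :: "(real \<Rightarrow> real) \<Rightarrow> bool" where
  "vanishing f \<longleftrightarrow> f \<in> borel_measurable borel \<and> (\<exists>B. \<forall>t. \<bar>f t\<bar> \<le> B) \<and> (f \<longlongrightarrow> 0) at_top"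

lemma vanishing_add: "vanishing f \<Longrightarrow> vanishing g \<Longrightarrow> vanishing (\<lambda>t. f t + g t)"
  unfolding vanishing_def
proof (elim conjE exE, intro conjI)
  fix B B' assume "\<forall>t. \<bar>f t\<bar> \<le> B" "\<forall>t. \<bar>g t\<bar> \<le> B'"
  then have "\<bar>f t + g t\<bar> \<le> B + B'" for t
    using abs_triangle_ineq[of "f t" "g t"] by (meson add_mono order_trans)
  then show "\<exists>B. \<forall>t. \<bar>f t + g t\<bar> \<le> B" by blast
qed (auto intro: tendsto_eq_intros)

lemma vanishing_bounded_mult:
  assumes "vanishing f" "h \<in> borel_measurable borel" "\<And>t. \<bar>h t\<bar> \<le> B"
  shows "vanishing (\<lambda>t. h t * f t)"
  unfolding vanishing_def
proof (intro conjI)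
  from assms obtain B' where B': "\<And>t. \<bar>f t\<bar> \<le> B'" by (auto simp: vanishing_def)
  have "0 \<le> B" using assms(3)[of 0] by linarith
  then have "\<bar>h t * f t\<bar> \<le> B * B'" for t
    using assms(3)[of t] B'[of t] by (simp add: abs_mult mult_mono)
  then show "\<exists>B. \<forall>t. \<bar>h t * f t\<bar> \<le> B" by blast
  have "((\<lambda>t. B * \<bar>f t\<bar>) \<longlongrightarrow> 0) at_top"
    using assms(1) by (auto simp: vanishing_def intro!: tendsto_eq_intros)
  then show "((\<lambda>t. h t * f t) \<longlongrightarrow> 0) at_top"
    by (rule Lim_null_comparison[rotated])
       (auto intro!: always_eventually mult_right_mono assms simp: abs_mult)
qed (use assms in \<open>auto simp: vanishing_def\<close>)

lemma vanishing_cmult: "vanishing f \<Longrightarrow> vanishing (\<lambda>t. c * f t)"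
  by (rule vanishing_bounded_mult[where B="\<bar>c\<bar>"]) auto

lemma vanishing_abs: "vanishing f \<Longrightarrow> vanishing (\<lambda>t. \<bar>f t\<bar>)"
  by (auto simp: vanishing_def intro: tendsto_rabs_zero)

context real_distribution
begin

lemma measurable_M_eq [simp]: "measurable M N = measurable borel N"
  by (rule measurable_cong_sets) auto

lemma prob_UNIV [simp]: "prob UNIV = 1"
  using prob_space by simp

lemma measurable_shift_mean [measurable]:
  assumes [measurable]: "f \<in> borel_measurable borel"
  shows "shift_mean f \<in> borel_measurable borel"
proof -
  have "sets (borel \<Otimes>\<^sub>M M) = sets (borel \<Otimes>\<^sub>M (borel :: real measure))"
    by (rule sets_pair_measure_cong) auto
  then have "(\<lambda>(t, u). f (t - u)) \<in> borel_measurable (borel \<Otimes>\<^sub>M M)"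
    by (subst measurable_cong_sets[OF _ refl]) measurable
  from borel_measurable_lebesgue_integral[OF this] show ?thesis
    by (simp add: shift_mean_def[abs_def])
qed

lemma integrable_shift:
  assumes [measurable]: "f \<in> borel_measurable borel" and "\<And>t. \<bar>f t\<bar> \<le> (B::real)"
  shows "integrable M (\<lambda>u. f (t - u))"
  by (rule integrable_const_bound[where B=B]) (use assms in auto)

lemma shift_mean_bounds:
  assumes "f \<in> borel_measurable borel" "\<And>t. a \<le> f t" "\<And>t. f t \<le> b"
  shows "a \<le> shift_mean f t" "shift_mean f t \<le> b"
proof -
  have "\<bar>f t\<bar> \<le> max \<bar>a\<bar> \<bar>b\<bar>" for t using assms(2)[of t] assms(3)[of t] by auto
  then have "integrable M (\<lambda>u. f (t - u))" using assms(1) by (rule integrable_shift[rotated])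
  then show "a \<le> shift_mean f t" "shift_mean f t \<le> b"
    unfolding shift_mean_def using assms by (auto intro!: integral_ge_const integral_le_const)
qed

lemma vanishing_shift_mean:
  assumes "vanishing f"
  shows "vanishing (shift_mean f)"
  unfolding vanishing_def
proof (intro conjI)
  from assms obtain B where [measurable]: "f \<in> borel_measurable borel" and B: "\<And>t. \<bar>f t\<bar> \<le> B"
    and lim: "(f \<longlongrightarrow> 0) at_top" by (auto simp: vanishing_def)
  show "shift_mean f \<in> borel_measurable borel" by measurable
  have "- B \<le> f t" "f t \<le> B" for t using B[of t] by auto
  then have "\<bar>shift_mean f t\<bar> \<le> B" for t using shift_mean_bounds[of f "-B" B t] by auto
  then show "\<exists>B. \<forall>t. \<bar>shift_mean f t\<bar> \<le> B" by blast
  have "((\<lambda>t. \<integral>u. f (t - u) \<partial>M) \<longlongrightarrow> (\<integral>u. 0 \<partial>M)) at_top"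
  proof (rule integral_dominated_convergence_at_top[where w="\<lambda>_. B"])
    show "AE u in M. ((\<lambda>t. f (t - u)) \<longlongrightarrow> 0) at_top"
    proof (rule AE_I2)
      fix u :: real
      have "filterlim (\<lambda>t. t - u) at_top at_top"
        using shift_at_top[of "- u"] by simp
      then show "((\<lambda>t. f (t - u)) \<longlongrightarrow> 0) at_top" by (rule filterlim_compose[OF lim])
    qed
  qed (use B in auto)
  then show "(shift_mean f \<longlongrightarrow> 0) at_top" by (simp add: shift_mean_def[abs_def])
qed

text \<open>
For a harmonic \<open>f\<close> the mean square increment is the expected gain of \<open>f\<^sup>2\<close> in one step of the random
walk.  Summed along the walk these gains telescope, so they are bounded by \<open>sup f\<^sup>2\<close>.
\<close>

lemma mean_square_increment_eq:
  assumes f: "f \<in> borel_measurable borel" "\<And>t. \<bar>f t\<bar> \<le> (B::real)"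
  shows "(\<integral>u. (f (t - u) - f t)\<^sup>2 \<partial>M) =
    shift_mean (\<lambda>t. (f t)\<^sup>2) t - (f t)\<^sup>2 + 2 * f t * (f t - shift_mean f t)"
proof -
  have i1: "integrable M (\<lambda>u. f (t - u))" by (rule integrable_shift[OF f])
  have i2: "integrable M (\<lambda>u. (f (t - u))\<^sup>2)"
    by (rule integrable_shift[where f="\<lambda>x. (f x)\<^sup>2" and B="B\<^sup>2"])
       (use f in \<open>auto intro!: power2_le_iff_abs_le[THEN iffD2] intro: order_trans[OF abs_ge_zero]\<close>)
  have "(\<integral>u. (f (t - u) - f t)\<^sup>2 \<partial>M) = (\<integral>u. (f (t - u))\<^sup>2 - 2 * f t * f (t - u) + (f t)\<^sup>2 \<partial>M)"
    by (simp add: power2_diff algebra_simps)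
  also have "\<dots> = (\<integral>u. (f (t - u))\<^sup>2 \<partial>M) - 2 * f t * (\<integral>u. f (t - u) \<partial>M) + (f t)\<^sup>2"
    using i1 i2 by (simp add: prob_space)
  finally show ?thesis by (simp add: shift_mean_def algebra_simps power2_eq_square)
qed

lemma shift_mean_diff:
  assumes "f \<in> borel_measurable borel" "\<And>t. \<bar>f t\<bar> \<le> (B::real)"
    "g \<in> borel_measurable borel" "\<And>t. \<bar>g t\<bar> \<le> (B'::real)"
  shows "shift_mean (\<lambda>t. f t - g t) t = shift_mean f t - shift_mean g t"
  unfolding shift_mean_def
  by (intro Bochner_Integration.integral_diff integrable_shift[OF assms(1,2)] integrable_shift[OF assms(3,4)])

text \<open>
The Cauchy-Schwarz inequality, read off from the variance being nonnegative.
\<close>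

lemma square_integral_le:
  assumes f: "f \<in> borel_measurable borel" "\<And>t. \<bar>f t\<bar> \<le> (B::real)"
  shows "(\<integral>u. f u \<partial>M)\<^sup>2 \<le> (\<integral>u. (f u)\<^sup>2 \<partial>M)"
proof -
  have i1: "integrable M f"
    by (rule integrable_const_bound[where B=B]) (use f in auto)
  have i2: "integrable M (\<lambda>u. (f u)\<^sup>2)"
    by (rule integrable_const_bound[where B="B\<^sup>2"])
       (use f in \<open>auto intro!: power2_le_iff_abs_le[THEN iffD2] intro: order_trans[OF abs_ge_zero]\<close>)
  have "0 \<le> (\<integral>u. (f u - expectation f)\<^sup>2 \<partial>M)" by simp
  also have "\<dots> = (\<integral>u. (f u)\<^sup>2 \<partial>M) - (expectation f)\<^sup>2"
    by (rule variance_eq[OF i1 i2])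
  finally show ?thesis by simp
qed

text \<open>
Shifts commute, so averaging the increment \<open>f(\<cdot> - u) - f\<close> over a further step reproduces it, up to the
defect \<open>\<gamma>\<close> of harmonicity.  Jensen's inequality for the square then shows that the mean square increment
does not decrease under averaging, again up to \<open>\<gamma>\<close>.
\<close>

lemma mean_square_increment_subharmonic:
  assumes f: "f \<in> borel_measurable borel" "\<And>t. \<bar>f t\<bar> \<le> (B::real)"
  defines "D \<equiv> \<lambda>t. \<integral>u. (f (t - u) - f t)\<^sup>2 \<partial>M"
  defines "\<gamma> \<equiv> \<lambda>t. f t - shift_mean f t"
  shows "D t \<le> shift_mean D t + 4 * B * (shift_mean (\<lambda>t. \<bar>\<gamma> t\<bar>) t + \<bar>\<gamma> t\<bar>)"
proof -
  note [measurable] = f(1)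
  have B: "0 \<le> B" using f(2)[of 0] by linarith
  have [measurable]: "\<gamma> \<in> borel_measurable borel" unfolding \<gamma>_def by measurable
  have sm: "\<bar>shift_mean f s\<bar> \<le> B" for s
    using shift_mean_bounds[of f "-B" B s] f(2) by (auto simp: abs_le_iff minus_le_iff)
  have \<gamma>B: "\<bar>\<gamma> s\<bar> \<le> 2 * B" for s
    using f(2)[of s] sm[of s] unfolding \<gamma>_def by linarith
  have fd: "\<bar>f a - f b\<bar> \<le> 2 * B" for a b
    using f(2)[of a] f(2)[of b] by linarith
  have sq: "(f a - f b)\<^sup>2 \<le> (2 * B)\<^sup>2" for a b
    by (rule power2_le_iff_abs_le[THEN iffD2]) (use fd[of a b] B in auto)
  have pair: "sets (M \<Otimes>\<^sub>M M) = sets (borel \<Otimes>\<^sub>M (borel :: real measure))"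
    by (rule sets_pair_measure_cong) auto
  interpret P: pair_prob_space M M ..
  have ip: "integrable (M \<Otimes>\<^sub>M M) (\<lambda>(u, v). (f (t - v - u) - f (t - v))\<^sup>2)"
    by (rule P.integrable_const_bound[where B="(2*B)\<^sup>2"])
       (use sq in \<open>auto simp: measurable_cong_sets[OF pair refl]\<close>)
  have "\<And>u. shift_mean (\<lambda>s. f (s - u) - f s) t = f (t - u) - f t - (\<gamma> (t - u) - \<gamma> t)"
  proof -
    fix u
    have "shift_mean (\<lambda>s. f (s - u) - f s) t = shift_mean (\<lambda>s. f (s - u)) t - shift_mean f t"
      by (rule shift_mean_diff[where B=B and B'=B]) (use f in auto)
    also have "shift_mean (\<lambda>s. f (s - u)) t = shift_mean f (t - u)"
      by (simp add: shift_mean_def algebra_simps)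
    finally show "?thesis u" by (simp add: \<gamma>_def)
  qed
  note avg = this
  have avg_sq: "(f (t - u) - f t - (\<gamma> (t - u) - \<gamma> t))\<^sup>2 \<le> (6 * B)\<^sup>2" for u
    by (rule power2_le_iff_abs_le[THEN iffD2])
       (use B fd[of "t-u" t] \<gamma>B[of "t-u"] \<gamma>B[of t] in \<open>simp; linarith\<close>)+
  have int_avg: "integrable M (\<lambda>u. (shift_mean (\<lambda>s. f (s - u) - f s) t)\<^sup>2)"
    unfolding avg by (rule integrable_const_bound[where B="(6*B)\<^sup>2"]) (use avg_sq in auto)
  have "D t - 4 * B * (shift_mean (\<lambda>t. \<bar>\<gamma> t\<bar>) t + \<bar>\<gamma> t\<bar>)
      = (\<integral>u. (f (t - u) - f t)\<^sup>2 - 4 * B * (\<bar>\<gamma> (t - u)\<bar> + \<bar>\<gamma> t\<bar>) \<partial>M)"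
  proof -
    have "integrable M (\<lambda>u. (f (t - u) - f t)\<^sup>2)"
      by (rule integrable_const_bound[where B="(2*B)\<^sup>2"]) (use sq in auto)
    moreover have "integrable M (\<lambda>u. \<bar>\<gamma> (t - u)\<bar>)"
      by (rule integrable_const_bound[where B="2*B"]) (use \<gamma>B in auto)
    ultimately show ?thesis
      by (simp add: D_def shift_mean_def prob_space algebra_simps)
  qed
  also have "\<dots> \<le> (\<integral>u. (shift_mean (\<lambda>s. f (s - u) - f s) t)\<^sup>2 \<partial>M)"
  proof (rule integral_mono)
    show "integrable M (\<lambda>u. (f (t - u) - f t)\<^sup>2 - 4 * B * (\<bar>\<gamma> (t - u)\<bar> + \<bar>\<gamma> t\<bar>))"
      by (intro Bochner_Integration.integrable_diff Bochner_Integration.integrable_add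
            integrable_mult_right integrable_const_bound[where B="(2*B)\<^sup>2"]
            integrable_const_bound[where B="2*B"]) (use sq \<gamma>B in auto)
    show "integrable M (\<lambda>u. (shift_mean (\<lambda>s. f (s - u) - f s) t)\<^sup>2)" by (rule int_avg)
    fix u
    let ?x = "f (t - u) - f t" and ?y = "\<gamma> (t - u) - \<gamma> t"
    have "?x * ?y \<le> \<bar>?x\<bar> * \<bar>?y\<bar>" by (metis abs_ge_self abs_mult)
    also have "\<dots> \<le> (2 * B) * (\<bar>\<gamma> (t - u)\<bar> + \<bar>\<gamma> t\<bar>)"
      by (intro mult_mono) (use fd B in \<open>auto intro!: abs_triangle_ineq4\<close>)
    finally have "?x\<^sup>2 - 4 * B * (\<bar>\<gamma> (t - u)\<bar> + \<bar>\<gamma> t\<bar>) \<le> ?x\<^sup>2 - 2 * (?x * ?y) + ?y\<^sup>2"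
      using zero_le_power2[of ?y] by linarith
    then show "?x\<^sup>2 - 4 * B * (\<bar>\<gamma> (t - u)\<bar> + \<bar>\<gamma> t\<bar>) \<le> (shift_mean (\<lambda>s. f (s - u) - f s) t)\<^sup>2"
      by (simp only: avg power2_diff[of ?x ?y] mult.assoc)
  qed
  also have "\<dots> \<le> (\<integral>u. (\<integral>v. (f (t - v - u) - f (t - v))\<^sup>2 \<partial>M) \<partial>M)"
  proof (rule integral_mono)
    show "integrable M (\<lambda>u. (\<integral>v. (f (t - v - u) - f (t - v))\<^sup>2 \<partial>M))"
      using P.integrable_fst[OF ip] by simp
    show "integrable M (\<lambda>u. (shift_mean (\<lambda>s. f (s - u) - f s) t)\<^sup>2)" by (rule int_avg)
    fix u
    show "(shift_mean (\<lambda>s. f (s - u) - f s) t)\<^sup>2 \<le> (\<integral>v. (f (t - v - u) - f (t - v))\<^sup>2 \<partial>M)"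
      unfolding shift_mean_def by (rule square_integral_le[where B="2*B"]) (use fd in auto)
  qed
  also have "\<dots> = (\<integral>v. (\<integral>u. (f (t - v - u) - f (t - v))\<^sup>2 \<partial>M) \<partial>M)"
    by (rule P.Fubini_integral[symmetric]) (use ip in simp)
  also have "\<dots> = shift_mean D t" by (simp add: shift_mean_def D_def)
  finally show ?thesis by simp
qed

text \<open>
Let \<open>D\<close> be the mean square increment, which is \<open>shift_mean (f\<^sup>2) - f\<^sup>2\<close> up to a vanishing term.  Since \<open>D\<close>
does not decrease under averaging, \<open>n D\<close> is at most the gain of \<open>f\<^sup>2\<close> in \<open>n\<close> steps plus a vanishing
term, hence at most \<open>B\<^sup>2 + o(1)\<close>, for every fixed \<open>n\<close>.
\<close>

lemma mean_square_increment_tendsto_0: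
  assumes f: "f \<in> borel_measurable borel" "\<And>t. \<bar>f t\<bar> \<le> (B::real)"
    and harm: "((\<lambda>t. f t - shift_mean f t) \<longlongrightarrow> 0) at_top"
  shows "((\<lambda>t. \<integral>u. (f (t - u) - f t)\<^sup>2 \<partial>M) \<longlongrightarrow> 0) at_top"
proof -
  note [measurable] = f(1)
  have B: "0 \<le> B" using f(2)[of 0] by linarith
  define D where "D = (\<lambda>t. \<integral>u. (f (t - u) - f t)\<^sup>2 \<partial>M)"
  define \<gamma> where "\<gamma> = (\<lambda>t. f t - shift_mean f t)"
  define \<psi> where "\<psi> = (\<lambda>t. (f t)\<^sup>2)"
  have \<psi>B: "0 \<le> \<psi> t" "\<psi> t \<le> B\<^sup>2" for t
    using f(2)[of t] B by (auto simp: \<psi>_def intro!: power2_le_iff_abs_le[THEN iffD2])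
  have [measurable]: "\<psi> \<in> borel_measurable borel" "\<gamma> \<in> borel_measurable borel"
    unfolding \<psi>_def \<gamma>_def by measurable
  have sm: "\<bar>shift_mean f s\<bar> \<le> B" for s
    using shift_mean_bounds[of f "-B" B s] f(2) by (auto simp: abs_le_iff minus_le_iff)
  have \<gamma>B: "\<bar>\<gamma> s\<bar> \<le> 2 * B" for s
    using f(2)[of s] sm[of s] unfolding \<gamma>_def by linarith
  have van\<gamma>: "vanishing \<gamma>"
    using \<gamma>B harm by (auto simp: vanishing_def \<gamma>_def[symmetric])
  define e where "e = (\<lambda>t. 4 * B * (shift_mean (\<lambda>t. \<bar>\<gamma> t\<bar>) t + \<bar>\<gamma> t\<bar>))"
  define e' where "e' = (\<lambda>t. 2 * f t * \<gamma> t)"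
  have van: "vanishing e" "vanishing e'"
    unfolding e_def e'_def
    by (intro vanishing_cmult vanishing_add vanishing_shift_mean vanishing_abs van\<gamma>
          vanishing_bounded_mult[where B="2 * B"]; use f(2) in \<open>auto simp: abs_mult\<close>)+
  have D_eq: "D t = shift_mean \<psi> t - \<psi> t + e' t" for t
    unfolding D_def \<psi>_def e'_def \<gamma>_def by (rule mean_square_increment_eq[OF f])
  have D_le: "D t \<le> shift_mean D t + e t" for t
    unfolding D_def e_def \<gamma>_def by (rule mean_square_increment_subharmonic[OF f])
  have [measurable]: "D \<in> borel_measurable borel"
    unfolding D_eq[abs_def] e'_def by measurable
  have D0: "0 \<le> D t" for t unfolding D_def by simp
  \<comment> \<open>\<open>\<xi>\<close> is \<open>f\<^sup>2\<close> averaged over \<open>n\<close> steps, so it inherits the bounds of \<open>f\<^sup>2\<close>.\<close>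
  have iterate: "\<exists>\<xi> h. \<xi> \<in> borel_measurable borel \<and> (\<forall>t. 0 \<le> \<xi> t \<and> \<xi> t \<le> B\<^sup>2) \<and> vanishing h \<and>
      (\<forall>t. real n * D t \<le> \<xi> t - \<psi> t + h t)" for n
  proof (induction n)
    case 0
    show ?case by (rule exI[of _ \<psi>], rule exI[of _ "\<lambda>_. 0"]) (use \<psi>B in \<open>auto simp: vanishing_def\<close>)
  next
    case (Suc n)
    then obtain \<xi> h where [measurable]: "\<xi> \<in> borel_measurable borel"
      and \<xi>: "\<And>t. 0 \<le> \<xi> t" "\<And>t. \<xi> t \<le> B\<^sup>2" and h: "vanishing h"
      and le: "\<And>t. real n * D t \<le> \<xi> t - \<psi> t + h t" by blast
    obtain Bh where [measurable]: "h \<in> borel_measurable borel" and Bh: "\<And>t. \<bar>h t\<bar> \<le> Bh"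
      using h by (auto simp: vanishing_def)
    have D_bound: "D t \<le> 4 * B\<^sup>2" for t
    proof -
      have "(f a - f b)\<^sup>2 \<le> (2 * B)\<^sup>2" for a b
        using f(2)[of a] f(2)[of b] B by (intro power2_le_iff_abs_le[THEN iffD2]) auto
      then have "(f a - f b)\<^sup>2 \<le> 4 * B\<^sup>2" for a b by (simp add: power_mult_distrib)
      then show ?thesis unfolding D_def
        by (intro integral_le_const integrable_const_bound[where B="4*B\<^sup>2"]) auto
    qed
    have Sn: "real (Suc n) * D t \<le> shift_mean \<xi> t - \<psi> t + (shift_mean h t + real n * e t + e' t)" for t
    proof -
      have "real n * D t \<le> real n * shift_mean D t + real n * e t"
        using mult_left_mono[OF D_le[of t], of "real n"] by (simp add: algebra_simps)
      moreover have "real n * shift_mean D t \<le> shift_mean \<xi> t - shift_mean \<psi> t + shift_mean h t"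
      proof -
      have "real n * shift_mean D t = (\<integral>u. real n * D (t - u) \<partial>M)"
        by (simp add: shift_mean_def)
      also have "\<dots> \<le> (\<integral>u. \<xi> (t - u) - \<psi> (t - u) + h (t - u) \<partial>M)"
      proof (rule integral_mono)
        show "integrable M (\<lambda>u. real n * D (t - u))"
          by (intro integrable_mult_right integrable_shift[of _ "4*B\<^sup>2"]) (use D0 D_bound in auto)
        show "integrable M (\<lambda>u. \<xi> (t - u) - \<psi> (t - u) + h (t - u))"
          by (intro Bochner_Integration.integrable_diff Bochner_Integration.integrable_add
               integrable_shift[of \<xi> "B\<^sup>2"] integrable_shift[of \<psi> "B\<^sup>2"] integrable_shift[of h Bh])
             (use \<xi> \<psi>B Bh in auto)
      qed (use le in auto)
      also have "\<dots> = shift_mean \<xi> t - shift_mean \<psi> t + shift_mean h t"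
      proof -
        have "integrable M (\<lambda>u. \<xi> (t - u))" "integrable M (\<lambda>u. \<psi> (t - u))" "integrable M (\<lambda>u. h (t - u))"
          by (intro integrable_shift[of \<xi> "B\<^sup>2"] integrable_shift[of \<psi> "B\<^sup>2"] integrable_shift[of h Bh];
              use \<xi> \<psi>B Bh in auto)+
        then show ?thesis by (simp add: shift_mean_def)
      qed
      finally show ?thesis .
      qed
      moreover have "real (Suc n) * D t = real n * D t + D t" by (simp add: distrib_right)
      ultimately show ?thesis using D_eq[of t] by linarith
    qed
    show ?case
    proof (intro exI conjI allI)
      show "shift_mean \<xi> \<in> borel_measurable borel" by measurable
      show "vanishing (\<lambda>t. shift_mean h t + real n * e t + e' t)"
        by (intro vanishing_add vanishing_cmult vanishing_shift_mean van h)
    qed (use Sn shift_mean_bounds[of \<xi> 0 "B\<^sup>2"] \<xi> in auto)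
  qed
  have "(D \<longlongrightarrow> 0) at_top"
  proof (rule order_tendstoI)
    fix a :: real assume "a < 0"
    then show "eventually (\<lambda>t. a < D t) at_top" using D0 by (intro always_eventually) (metis less_le_trans)
  next
    fix a :: real assume "0 < a"
    obtain n :: nat where n: "(B\<^sup>2 + 1) / a < real n" using reals_Archimedean2 by blast
    obtain \<xi> h where \<xi>: "\<And>t. \<xi> t \<le> B\<^sup>2" and h: "vanishing h"
      and le: "\<And>t. real n * D t \<le> \<xi> t - \<psi> t + h t" using iterate[of n] by blast
    have "eventually (\<lambda>t. h t < 1) at_top"
      using h order_tendstoD(2)[of h 0 at_top 1] by (simp add: vanishing_def)
    then show "eventually (\<lambda>t. D t < a) at_top"
    proof eventually_elim
      case (elim t)
      then have "real n * D t < B\<^sup>2 + 1" using le[of t] \<xi>[of t] \<psi>B(1)[of t] by linarith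
      also have "\<dots> < real n * a" using n \<open>0 < a\<close> by (simp add: field_simps)
      finally show ?case by (simp add: mult_less_cancel_left)
    qed
  qed
  then show ?thesis by (simp add: D_def)
qed

text \<open>
An asymptotic Choquet-Deny theorem.  The shifts \<open>a\<close> with \<open>f(t - a) - f(t) \<longlongrightarrow> 0\<close> form a subgroup \<open>G\<close> of the
line.  It contains the support of the step distribution, because the mean square increment tends to
\<open>0\<close> and \<open>f\<close> is Lipschitz.  If \<open>G\<close> had no arbitrarily small positive elements, it would lie in some
\<open>d\<int>\<close>, and so would almost every step, which is excluded.  Hence \<open>G\<close> is dense, and by the Lipschitz
property it is the whole line.
\<close>

lemma lipschitz_increments_tendsto_0:
  assumes f: "f \<in> borel_measurable borel" "\<And>t. \<bar>f t\<bar> \<le> (B::real)"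
    and lip: "\<And>s t. \<bar>f s - f t\<bar> \<le> L * \<bar>s - t\<bar>"
    and harm: "((\<lambda>t. f t - shift_mean f t) \<longlongrightarrow> 0) at_top"
    and nonarith: "\<And>d. d > 0 \<Longrightarrow> emeasure M (UNIV - range (\<lambda>k::int. d * of_int k)) \<noteq> 0"
  shows "((\<lambda>t. f (t - a) - f t) \<longlongrightarrow> 0) at_top"
proof -
  note [measurable] = f(1)
  have L: "0 \<le> L" using lip[of 1 0] by simp
  have shift: "filterlim (\<lambda>t. t - c) at_top at_top" for c :: real
    using shift_at_top[of "- c"] by simp
  define G where "G = {a. ((\<lambda>t. f (t - a) - f t) \<longlongrightarrow> 0) at_top}"
  \<comment> \<open>The approximating shift \<open>b\<close> may change with \<open>t\<close>, as the steps that witness the support near \<open>a\<close> do.\<close>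
  have near: "a \<in> G"
    if "\<And>\<kappa>. \<kappa> > 0 \<Longrightarrow> \<forall>\<^sub>F t in at_top. \<exists>b. \<bar>a - b\<bar> \<le> \<kappa> \<and> \<bar>f (t - b) - f t\<bar> \<le> \<kappa>" for a
    unfolding G_def mem_Collect_eq
  proof (rule tendstoI)
    fix e :: real assume "0 < e"
    define \<kappa> where "\<kappa> = e / (2 * (L + 1))"
    have \<kappa>: "0 < \<kappa>" "(L + 1) * \<kappa> < e"
      using L \<open>0 < e\<close> by (auto simp: \<kappa>_def field_simps add_pos_nonneg)
    from that[OF \<kappa>(1)] show "\<forall>\<^sub>F t in at_top. dist (f (t - a) - f t) 0 < e"
    proof eventually_elim
      case (elim t)
      then obtain b where b: "\<bar>a - b\<bar> \<le> \<kappa>" "\<bar>f (t - b) - f t\<bar> \<le> \<kappa>" by blast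
      have "\<bar>f (t - a) - f (t - b)\<bar> \<le> L * \<kappa>"
        using lip[of "t - a" "t - b"] mult_left_mono[OF b(1) L] by (simp add: abs_minus_commute)
      then have "\<bar>f (t - a) - f t\<bar> \<le> (L + 1) * \<kappa>"
        using b(2) by (simp add: distrib_right)
      then show ?case using \<kappa>(2) by simp
    qed
  qed
  have diff: "x - y \<in> G" if "x \<in> G" "y \<in> G" for x y
  proof -
    have "((\<lambda>t. f (t + y - x) - f (t + y)) \<longlongrightarrow> 0) at_top"
      using that(1) filterlim_compose[OF _ shift[of "-y"], of "\<lambda>t. f (t - x) - f t"] by (simp add: G_def)
    moreover have "((\<lambda>t. f (t + y - y) - f (t + y)) \<longlongrightarrow> 0) at_top"
      using that(2) filterlim_compose[OF _ shift[of "-y"], of "\<lambda>t. f (t - y) - f t"] by (simp add: G_def)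
    ultimately have "((\<lambda>t. (f (t + y - x) - f (t + y)) - (f (t + y - y) - f (t + y))) \<longlongrightarrow> 0 - 0) at_top"
      by (rule tendsto_diff)
    then show ?thesis by (simp add: G_def algebra_simps)
  qed
  have zero: "0 \<in> G" by (simp add: G_def)
  have D: "((\<lambda>t. \<integral>u. (f (t - u) - f t)\<^sup>2 \<partial>M) \<longlongrightarrow> 0) at_top"
    by (rule mean_square_increment_tendsto_0[OF f harm])
  have support: "a \<in> G" if pos: "\<And>x y. x < a \<Longrightarrow> a < y \<Longrightarrow> measure M {x<..<y} > 0" for a
  proof (rule near)
    fix \<kappa> :: real assume "0 < \<kappa>"
    define I where "I = {a - \<kappa> <..< a + \<kappa>}"
    have [measurable]: "I \<in> sets borel" by (simp add: I_def)
    have m: "measure M I > 0" unfolding I_def using \<open>0 < \<kappa>\<close> by (intro pos) auto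
    have "\<kappa>\<^sup>2 * measure M I > 0" using m \<open>0 < \<kappa>\<close> by simp
    from order_tendstoD(2)[OF D this]
    show "\<forall>\<^sub>F t in at_top. \<exists>b. \<bar>a - b\<bar> \<le> \<kappa> \<and> \<bar>f (t - b) - f t\<bar> \<le> \<kappa>"
    proof eventually_elim
      case (elim t)
      show ?case
      proof (rule ccontr)
        assume "\<not> ?thesis"
        then have far: "\<kappa> < \<bar>f (t - b) - f t\<bar>" if "b \<in> I" for b
        proof -
          have "\<bar>a - b\<bar> \<le> \<kappa>" using that by (auto simp: I_def)
          then show ?thesis using \<open>\<not> _\<close> by (meson not_le)
        qed
        have "\<kappa>\<^sup>2 * measure M I = (\<integral>u. \<kappa>\<^sup>2 * indicator I u \<partial>M)" by simp
        also have "\<dots> \<le> (\<integral>u. (f (t - u) - f t)\<^sup>2 \<partial>M)"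
        proof (rule integral_mono)
          have "(f (t - u) - f t)\<^sup>2 \<le> (2 * B)\<^sup>2" for u
            using f(2)[of "t - u"] f(2)[of t] by (intro power2_le_iff_abs_le[THEN iffD2]) auto
          then show "integrable M (\<lambda>u. (f (t - u) - f t)\<^sup>2)"
            by (intro integrable_const_bound[where B="(2*B)\<^sup>2"]) auto
          show "\<kappa>\<^sup>2 * indicator I u \<le> (f (t - u) - f t)\<^sup>2" for u
            using far[of u] \<open>0 < \<kappa>\<close> power_mono[of \<kappa> "\<bar>f (t - u) - f t\<bar>" 2]
            by (auto simp: indicator_def)
        qed (auto intro!: integrable_mult_right integrable_real_indicator emeasure_finite simp: less_top[symmetric])
        finally show False using elim by simp
      qed
    qed
  qed
  have dense: "\<exists>x\<in>G. 0 < x \<and> x < d0" if "0 < d0" for d0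
  proof (rule ccontr)
    assume "\<not> ?thesis"
    then have "\<exists>d>0. G \<subseteq> range (\<lambda>k::int. d * of_int k)"
      using that by (intro subgroup_without_small_elements[of G d0] zero diff) (auto simp: not_less)
    then obtain d where d: "d > 0" "G \<subseteq> range (\<lambda>k::int. d * of_int k)" by blast
    \<comment> \<open>The points outside the support are covered by countably many null intervals.\<close>
    define Q where "Q = {(x, y). x \<in> \<rat> \<and> y \<in> \<rat> \<and> measure M {x<..<y} = 0}"
    have "Q \<subseteq> \<rat> \<times> \<rat>" by (auto simp: Q_def)
    then have Q: "countable Q" by (rule countable_subset) (intro countable_SIGMA countable_rat)
    have "UNIV - range (\<lambda>k::int. d * of_int k) \<subseteq> (\<Union>(x, y)\<in>Q. {x<..<y})"
    proof
      fix a assume "a \<in> UNIV - range (\<lambda>k::int. d * of_int k)"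
      then have "a \<notin> G" using d by auto
      then obtain x y where xy: "x < a" "a < y" "\<not> measure M {x<..<y} > 0" using support by blast
      obtain x' y' where xy': "x' \<in> \<rat>" "y' \<in> \<rat>" "x < x'" "x' < a" "a < y'" "y' < y"
        using Rats_dense_in_real xy by meson
      have "measure M {x'<..<y'} \<le> measure M {x<..<y}"
        using xy' by (intro finite_measure_mono) auto
      then have "measure M {x'<..<y'} = 0" using xy(3) measure_nonneg[of M "{x'<..<y'}"] by linarith
      then show "a \<in> (\<Union>(x, y)\<in>Q. {x<..<y})" using xy' by (force simp: Q_def)
    qed
    moreover have "(\<Union>(x, y)\<in>Q. {x<..<y}) \<in> null_sets M"
      by (intro null_sets_UN' Q) (auto simp: Q_def null_sets_def emeasure_eq_measure)
    ultimately have "emeasure M (UNIV - range (\<lambda>k::int. d * of_int k)) = 0"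
      by (metis emeasure_eq_0 null_setsD1 null_setsD2)
    then show False using nonarith[OF d(1)] by simp
  qed
  have "a \<in> G"
  proof (rule near)
    fix \<kappa> :: real assume "0 < \<kappa>"
    obtain x where x: "x \<in> G" "0 < x" "x < \<kappa>" using dense[OF \<open>0 < \<kappa>\<close>] by blast
    define b where "b = x * of_int \<lfloor>a / x\<rfloor>"
    have "b \<in> G" unfolding b_def by (rule subgroup_multiple[OF zero diff x(1)])
    have "\<bar>a - b\<bar> \<le> x"
      using floor_divide_lower[OF x(2), of a] floor_divide_upper[OF x(2), of a]
      by (auto simp: b_def algebra_simps)
    then have ab: "\<bar>a - b\<bar> \<le> \<kappa>" using x by simp
    have "\<forall>\<^sub>F t in at_top. dist (f (t - b) - f t) 0 < \<kappa>"
      using \<open>b \<in> G\<close> \<open>0 < \<kappa>\<close> by (auto simp: G_def dest: tendstoD)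
    then show "\<forall>\<^sub>F t in at_top. \<exists>b. \<bar>a - b\<bar> \<le> \<kappa> \<and> \<bar>f (t - b) - f t\<bar> \<le> \<kappa>"
      by eventually_elim (use ab in \<open>auto intro!: exI[of _ b]\<close>)
  qed
  then show ?thesis by (simp add: G_def)
qed

end

section \<open>Expected visits to a unit interval\<close>

context real_distribution
begin

definition forward_mean :: "(real \<Rightarrow> ennreal) \<Rightarrow> real \<Rightarrow> ennreal" where
  "forward_mean f y = (\<integral>\<^sup>+u. f (y + u) \<partial>M)"

definition backward_mean :: "(real \<Rightarrow> ennreal) \<Rightarrow> real \<Rightarrow> ennreal" where
  "backward_mean f t = (\<integral>\<^sup>+u. f (t - u) \<partial>M)"

lemma sets_pair_M: "sets (borel \<Otimes>\<^sub>M M) = sets (borel \<Otimes>\<^sub>M (borel :: real measure))"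
  by (rule sets_pair_measure_cong) auto

lemma measurable_forward_mean [measurable]:
  assumes [measurable]: "f \<in> borel_measurable borel"
  shows "forward_mean f \<in> borel_measurable borel"
proof -
  have "(\<lambda>(y, u). f (y + u)) \<in> borel_measurable (borel \<Otimes>\<^sub>M M)"
    by (subst measurable_cong_sets[OF sets_pair_M refl]) measurable
  from borel_measurable_nn_integral[OF this] show ?thesis by (simp add: forward_mean_def[abs_def])
qed

lemma measurable_backward_mean [measurable]:
  assumes [measurable]: "f \<in> borel_measurable borel"
  shows "backward_mean f \<in> borel_measurable borel"
proof -
  have "(\<lambda>(y, u). f (y - u)) \<in> borel_measurable (borel \<Otimes>\<^sub>M M)"
    by (subst measurable_cong_sets[OF sets_pair_M refl]) measurable
  from borel_measurable_nn_integral[OF this] show ?thesis by (simp add: backward_mean_def[abs_def])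
qed

lemma measurable_forward_mean_power [measurable]:
  "f \<in> borel_measurable borel \<Longrightarrow> (forward_mean ^^ n) f \<in> borel_measurable borel"
  by (induction n) auto

lemma measurable_backward_mean_power [measurable]:
  "f \<in> borel_measurable borel \<Longrightarrow> (backward_mean ^^ n) f \<in> borel_measurable borel"
  by (induction n) auto

text \<open>
Lebesgue measure is invariant under every shift, so the two averaging operators are adjoint to
each other.
\<close>

lemma backward_mean_adjoint:
  assumes [measurable]: "f \<in> borel_measurable borel" "h \<in> borel_measurable borel"
  shows "(\<integral>\<^sup>+t. f t * backward_mean h t \<partial>lborel) = (\<integral>\<^sup>+y. forward_mean f y * h y \<partial>lborel)"
proof -
  interpret P: pair_sigma_finite lborel M
    by (intro pair_sigma_finite.intro sigma_finite_lborel sigma_finite_measure_axioms)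
  have sets: "sets (lborel \<Otimes>\<^sub>M M) = sets (borel \<Otimes>\<^sub>M (borel :: real measure))"
    by (rule sets_pair_measure_cong) auto
  have m1: "(\<lambda>(t, u). f t * h (t - u)) \<in> borel_measurable (lborel \<Otimes>\<^sub>M M)"
    and m2: "(\<lambda>(y, u). f (y + u) * h y) \<in> borel_measurable (lborel \<Otimes>\<^sub>M M)"
    by (subst measurable_cong_sets[OF sets refl], measurable)+
  have "(\<integral>\<^sup>+t. f t * backward_mean h t \<partial>lborel) = (\<integral>\<^sup>+t. \<integral>\<^sup>+u. f t * h (t - u) \<partial>M \<partial>lborel)"
    by (simp add: backward_mean_def nn_integral_cmult)
  also have "\<dots> = (\<integral>\<^sup>+u. \<integral>\<^sup>+t. f t * h (t - u) \<partial>lborel \<partial>M)"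
    using P.Fubini[OF m1] by simp
  also have "\<dots> = (\<integral>\<^sup>+u. \<integral>\<^sup>+y. f (y + u) * h y \<partial>lborel \<partial>M)"
  proof (rule nn_integral_cong)
    fix u
    show "(\<integral>\<^sup>+t. f t * h (t - u) \<partial>lborel) = (\<integral>\<^sup>+y. f (y + u) * h y \<partial>lborel)"
      by (subst nn_integral_real_affine[where c=1 and t=u]) (auto simp: add.commute)
  qed
  also have "\<dots> = (\<integral>\<^sup>+y. \<integral>\<^sup>+u. f (y + u) * h y \<partial>M \<partial>lborel)"
    using P.Fubini[OF m2] by simp
  finally show ?thesis by (simp add: forward_mean_def nn_integral_multc)
qed

lemma backward_mean_power_adjoint:
  assumes [measurable]: "f \<in> borel_measurable borel" "h \<in> borel_measurable borel"
  shows "(\<integral>\<^sup>+t. f t * (backward_mean ^^ n) h t \<partial>lborel) = (\<integral>\<^sup>+y. (forward_mean ^^ n) f y * h y \<partial>lborel)"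
  using assms(1)
proof (induction n arbitrary: f)
  case (Suc n)
  note [measurable] = Suc.prems
  have "(\<integral>\<^sup>+t. f t * (backward_mean ^^ Suc n) h t \<partial>lborel)
      = (\<integral>\<^sup>+t. forward_mean f t * (backward_mean ^^ n) h t \<partial>lborel)"
    by (simp add: backward_mean_adjoint)
  also have "\<dots> = (\<integral>\<^sup>+y. (forward_mean ^^ n) (forward_mean f) y * h y \<partial>lborel)"
    by (rule Suc.IH) measurable
  finally show ?case by (simp add: funpow_Suc_right del: funpow.simps)
qed simp

lemma forward_mean_mono: "(\<And>y. f y \<le> h y) \<Longrightarrow> forward_mean f y \<le> forward_mean h y"
  unfolding forward_mean_def by (intro nn_integral_mono) auto

lemma backward_mean_mono: "(\<And>y. f y \<le> h y) \<Longrightarrow> backward_mean f y \<le> backward_mean h y"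
  unfolding backward_mean_def by (intro nn_integral_mono) auto

end

text \<open>
An exponential moment below \<open>1\<close> on the negative side encodes the upward drift of the random walk: the
function \<open>e\<^bsup>-\<epsilon>y\<^esup>\<close> contracts by the factor \<open>\<rho>\<close> in each step.
\<close>

locale negative_exponential_moment = real_distribution +
  fixes \<epsilon> \<rho> :: real
  assumes \<epsilon>_pos: "0 < \<epsilon>"
    and exp_integrable: "integrable M (\<lambda>u. exp (- \<epsilon> * u))"
    and exp_moment: "(\<integral>u. exp (- \<epsilon> * u) \<partial>M) = \<rho>"
    and \<rho>_less_1: "\<rho> < 1"
begin

lemma \<rho>_nonneg: "0 \<le> \<rho>"
  unfolding exp_moment[symmetric] by simp

lemma nn_exp_moment: "(\<integral>\<^sup>+u. ennreal (exp (- \<epsilon> * u)) \<partial>M) = ennreal \<rho>"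
  using nn_integral_eq_integral[OF exp_integrable] exp_moment by simp

lemma forward_mean_exp:
  assumes "0 \<le> c"
  shows "forward_mean (\<lambda>y. ennreal (c * exp (- \<epsilon> * y))) y = ennreal (c * \<rho> * exp (- \<epsilon> * y))"
proof -
  have "forward_mean (\<lambda>y. ennreal (c * exp (- \<epsilon> * y))) y
      = (\<integral>\<^sup>+u. ennreal (c * exp (- \<epsilon> * y)) * ennreal (exp (- \<epsilon> * u)) \<partial>M)"
    unfolding forward_mean_def using assms
    by (intro nn_integral_cong) (simp add: ennreal_mult[symmetric] exp_add[symmetric] algebra_simps)
  also have "\<dots> = ennreal (c * exp (- \<epsilon> * y)) * ennreal \<rho>"
    by (subst nn_integral_cmult) (simp_all add: nn_exp_moment[simplified])
  finally show ?thesis using assms \<rho>_nonneg by (simp add: ennreal_mult[symmetric] algebra_simps)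
qed

lemma backward_mean_exp:
  assumes "0 \<le> c"
  shows "backward_mean (\<lambda>y. ennreal (c * exp (\<epsilon> * y))) t = ennreal (c * \<rho> * exp (\<epsilon> * t))"
proof -
  have "backward_mean (\<lambda>y. ennreal (c * exp (\<epsilon> * y))) t
      = (\<integral>\<^sup>+u. ennreal (c * exp (\<epsilon> * t)) * ennreal (exp (- \<epsilon> * u)) \<partial>M)"
    unfolding backward_mean_def using assms
    by (intro nn_integral_cong) (simp add: ennreal_mult[symmetric] exp_add[symmetric] algebra_simps)
  also have "\<dots> = ennreal (c * exp (\<epsilon> * t)) * ennreal \<rho>"
    by (subst nn_integral_cmult) (simp_all add: nn_exp_moment[simplified])
  finally show ?thesis using assms \<rho>_nonneg by (simp add: ennreal_mult[symmetric] algebra_simps)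
qed

lemma forward_mean_power_exp_le:
  assumes "\<And>y. f y \<le> ennreal (c * exp (- \<epsilon> * y))" "0 \<le> c"
  shows "(forward_mean ^^ n) f y \<le> ennreal (c * \<rho> ^ n * exp (- \<epsilon> * y))"
proof (induction n arbitrary: y)
  case (Suc n)
  have "(forward_mean ^^ Suc n) f y \<le> forward_mean (\<lambda>y. ennreal (c * \<rho> ^ n * exp (- \<epsilon> * y))) y"
    by (simp, intro forward_mean_mono) (use Suc in simp)
  also have "\<dots> = ennreal (c * \<rho> ^ n * \<rho> * exp (- \<epsilon> * y))"
    by (rule forward_mean_exp) (use assms \<rho>_nonneg in simp)
  finally show ?case by (simp add: algebra_simps)
qed (use assms in simp)

lemma backward_mean_power_exp_le:
  assumes "\<And>y. f y \<le> ennreal (c * exp (\<epsilon> * y))" "0 \<le> c"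
  shows "(backward_mean ^^ n) f y \<le> ennreal (c * \<rho> ^ n * exp (\<epsilon> * y))"
proof (induction n arbitrary: y)
  case (Suc n)
  have "(backward_mean ^^ Suc n) f y \<le> backward_mean (\<lambda>y. ennreal (c * \<rho> ^ n * exp (\<epsilon> * y))) y"
    by (simp, intro backward_mean_mono) (use Suc in simp)
  also have "\<dots> = ennreal (c * \<rho> ^ n * \<rho> * exp (\<epsilon> * y))"
    by (rule backward_mean_exp) (use assms \<rho>_nonneg in simp)
  finally show ?case by (simp add: algebra_simps)
qed (use assms in simp)

lemma sum_forward_mean_power_Suc:
  assumes [measurable]: "f \<in> borel_measurable borel"
  shows "(\<Sum>k<Suc n. (forward_mean ^^ k) f y) = f y + forward_mean (\<lambda>y. \<Sum>k<n. (forward_mean ^^ k) f y) y"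
proof -
  have "forward_mean (\<lambda>y. \<Sum>k<n. (forward_mean ^^ k) f y) y = (\<Sum>k<n. (forward_mean ^^ Suc k) f y)"
    by (simp add: forward_mean_def nn_integral_sum)
  then show ?thesis by (simp add: sum.lessThan_Suc_shift del: sum.lessThan_Suc)
qed

text \<open>
Inside the interval the contraction of \<open>e\<^bsup>-\<epsilon>y\<^esup>\<close> gives a geometric series.  Outside, the interval
contributes nothing at time \<open>0\<close>, so the expected number of visits is an average of its values after
one step and cannot exceed the bound; this is the maximum principle.
\<close>

lemma renewal_of_unit_interval_le:
  "(\<Sum>k<n. (forward_mean ^^ k) (indicator {t..t+1}) y) \<le> ennreal (exp \<epsilon> / (1 - \<rho>))"
proof (induction n arbitrary: y)
  case (Suc n)
  let ?I = "indicator {t..t+1} :: real \<Rightarrow> ennreal"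
  show ?case
  proof (cases "y \<in> {t..t+1}")
    case True
    have "?I x \<le> ennreal (exp (\<epsilon> * (t + 1)) * exp (- \<epsilon> * x))" for x
    proof (cases "x \<in> {t..t+1}")
      case True
      have "\<epsilon> * x \<le> \<epsilon> * (t + 1)" using True \<epsilon>_pos by simp
      then have "1 \<le> exp (\<epsilon> * (t + 1)) * exp (- \<epsilon> * x)" by (simp add: exp_add[symmetric])
      then have "ennreal 1 \<le> ennreal (exp (\<epsilon> * (t + 1)) * exp (- \<epsilon> * x))" by (rule ennreal_leI)
      then show ?thesis using True by simp
    qed simp
    from forward_mean_power_exp_le[OF this]
    have le: "(forward_mean ^^ k) ?I y \<le> ennreal (exp (\<epsilon> * (t + 1)) * \<rho> ^ k * exp (- \<epsilon> * y))" for k by simp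
    have "\<epsilon> * t \<le> \<epsilon> * y" using True \<epsilon>_pos by simp
    then have "exp (\<epsilon> * (t + 1)) * exp (- \<epsilon> * y) \<le> exp \<epsilon>" by (simp add: exp_add[symmetric] algebra_simps)
    then have "exp (\<epsilon> * (t + 1)) * exp (- \<epsilon> * y) * \<rho> ^ k \<le> exp \<epsilon> * \<rho> ^ k" for k
      by (rule mult_right_mono) (use \<rho>_nonneg in simp)
    then have "(forward_mean ^^ k) ?I y \<le> ennreal (exp \<epsilon> * \<rho> ^ k)" for k
      by (intro order_trans[OF le] ennreal_leI) (simp add: algebra_simps)
    then have "(\<Sum>k<Suc n. (forward_mean ^^ k) ?I y) \<le> (\<Sum>k<Suc n. ennreal (exp \<epsilon> * \<rho> ^ k))"
      by (intro sum_mono)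
    also have "\<dots> = ennreal (exp \<epsilon> * (\<Sum>k<Suc n. \<rho> ^ k))"
      by (subst sum_ennreal) (use \<rho>_nonneg in \<open>auto simp: sum_distrib_left distrib_left\<close>)
    also have "\<dots> \<le> ennreal (exp \<epsilon> / (1 - \<rho>))"
    proof (rule ennreal_leI)
      have "(\<Sum>k<Suc n. \<rho> ^ k) \<le> 1 / (1 - \<rho>)"
        using \<rho>_nonneg \<rho>_less_1 by (subst sum_gp_strict) (auto simp: divide_right_mono)
      then show "exp \<epsilon> * (\<Sum>k<Suc n. \<rho> ^ k) \<le> exp \<epsilon> / (1 - \<rho>)"
        using mult_left_mono[of _ "1 / (1 - \<rho>)" "exp \<epsilon>"] by simp
    qed
    finally show ?thesis .
  next
    case False
    have "(\<Sum>k<Suc n. (forward_mean ^^ k) ?I y) = forward_mean (\<lambda>y. \<Sum>k<n. (forward_mean ^^ k) ?I y) y"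
      using False by (subst sum_forward_mean_power_Suc) auto
    also have "\<dots> \<le> forward_mean (\<lambda>_. ennreal (exp \<epsilon> / (1 - \<rho>))) y"
      by (rule forward_mean_mono) (rule Suc)
    also have "\<dots> = ennreal (exp \<epsilon> / (1 - \<rho>))"
      using emeasure_space_1 by (simp add: forward_mean_def)
    finally show ?thesis .
  qed
qed simp

text \<open>
Iterating the inequality bounds \<open>r\<close> by the sum of the iterated averages of \<open>h\<close>; the remainder decays like
\<open>\<rho>\<^sup>n\<close> by the growth bound.  Moving the averages to the indicator of the interval by duality turns the
sum into expected numbers of visits.
\<close>

lemma unit_interval_integral_le:
  assumes [measurable]: "r \<in> borel_measurable borel" "h \<in> borel_measurable borel"
    and sub: "\<And>t. r t \<le> h t + backward_mean r t"
    and growth: "\<And>t. r t \<le> ennreal (c * exp (\<epsilon> * t))" "0 \<le> c"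
  shows "(\<integral>\<^sup>+s. indicator {t..t+1} s * r s \<partial>lborel) \<le> ennreal (exp \<epsilon> / (1 - \<rho>)) * (\<integral>\<^sup>+s. h s \<partial>lborel)"
proof -
  let ?I = "indicator {t..t+1} :: real \<Rightarrow> ennreal"
  have iter: "r s \<le> (\<Sum>k<n. (backward_mean ^^ k) h s) + (backward_mean ^^ n) r s" for n s
  proof (induction n)
    case (Suc n)
    have "(backward_mean ^^ n) r s \<le> (backward_mean ^^ n) h s + (backward_mean ^^ Suc n) r s" for s
    proof (induction n arbitrary: s)
      case (Suc n)
      have "(backward_mean ^^ Suc n) r s
          \<le> backward_mean (\<lambda>s. (backward_mean ^^ n) h s + (backward_mean ^^ Suc n) r s) s"
        by (simp, intro backward_mean_mono) (use Suc in simp)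
      also have "\<dots> = (backward_mean ^^ Suc n) h s + (backward_mean ^^ Suc (Suc n)) r s"
        by (simp add: backward_mean_def[of "\<lambda>s. _ s + _ s"] nn_integral_add)
           (simp add: backward_mean_def)
      finally show ?case .
    qed (use sub in simp)
    then have "(\<Sum>k<n. (backward_mean ^^ k) h s) + (backward_mean ^^ n) r s
        \<le> (\<Sum>k<n. (backward_mean ^^ k) h s) + ((backward_mean ^^ n) h s + (backward_mean ^^ Suc n) r s)"
      by (intro add_left_mono)
    from order_trans[OF Suc this] show ?case by (simp add: add.assoc)
  qed simp
  have le: "(\<integral>\<^sup>+s. ?I s * r s \<partial>lborel) \<le> ennreal (exp \<epsilon> / (1 - \<rho>)) * (\<integral>\<^sup>+s. h s \<partial>lborel)
      + ennreal (c * exp (\<epsilon> * (t + 1)) * \<rho> ^ n)" for n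
  proof -
    have "(\<integral>\<^sup>+s. ?I s * r s \<partial>lborel) \<le>
        (\<integral>\<^sup>+s. (\<Sum>k<n. ?I s * (backward_mean ^^ k) h s) + ?I s * ennreal (c * exp (\<epsilon> * (t + 1)) * \<rho> ^ n) \<partial>lborel)"
    proof (rule nn_integral_mono)
      fix s
      show "?I s * r s \<le> (\<Sum>k<n. ?I s * (backward_mean ^^ k) h s) + ?I s * ennreal (c * exp (\<epsilon> * (t + 1)) * \<rho> ^ n)"
      proof (cases "s \<in> {t..t+1}")
        case True
        have "(backward_mean ^^ n) r s \<le> ennreal (c * \<rho> ^ n * exp (\<epsilon> * s))"
          by (rule backward_mean_power_exp_le[OF growth])
        also have "\<dots> \<le> ennreal (c * exp (\<epsilon> * (t + 1)) * \<rho> ^ n)"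
        proof (rule ennreal_leI)
          have "exp (\<epsilon> * s) \<le> exp (\<epsilon> * (t + 1))" using True \<epsilon>_pos by simp
          then have "(c * \<rho> ^ n) * exp (\<epsilon> * s) \<le> (c * \<rho> ^ n) * exp (\<epsilon> * (t + 1))"
            by (rule mult_left_mono) (use growth(2) \<rho>_nonneg in simp)
          then show "c * \<rho> ^ n * exp (\<epsilon> * s) \<le> c * exp (\<epsilon> * (t + 1)) * \<rho> ^ n" by (simp add: ac_simps)
        qed
        finally have "r s \<le> (\<Sum>k<n. (backward_mean ^^ k) h s) + ennreal (c * exp (\<epsilon> * (t + 1)) * \<rho> ^ n)"
          using iter[of s n] by (meson add_left_mono order_trans)
        then show ?thesis using True by simp
      qed simp
    qed
    also have "\<dots> = (\<Sum>k<n. \<integral>\<^sup>+s. ?I s * (backward_mean ^^ k) h s \<partial>lborel) + ennreal (c * exp (\<epsilon> * (t + 1)) * \<rho> ^ n)"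
      by (subst nn_integral_add, simp, simp, subst nn_integral_sum, simp, subst nn_integral_multc, simp, simp)
    also have "(\<Sum>k<n. \<integral>\<^sup>+s. ?I s * (backward_mean ^^ k) h s \<partial>lborel)
        = (\<Sum>k<n. \<integral>\<^sup>+s. (forward_mean ^^ k) ?I s * h s \<partial>lborel)"
      by (intro sum.cong refl backward_mean_power_adjoint) auto
    also have "\<dots> = (\<integral>\<^sup>+s. (\<Sum>k<n. (forward_mean ^^ k) ?I s) * h s \<partial>lborel)"
      by (simp add: nn_integral_sum sum_distrib_right)
    also have "\<dots> \<le> (\<integral>\<^sup>+s. ennreal (exp \<epsilon> / (1 - \<rho>)) * h s \<partial>lborel)"
      by (intro nn_integral_mono mult_right_mono renewal_of_unit_interval_le) auto
    finally show ?thesis by (simp add: nn_integral_cmult)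
  qed
  have "(\<lambda>n. ennreal (exp \<epsilon> / (1 - \<rho>)) * (\<integral>\<^sup>+s. h s \<partial>lborel) + ennreal (c * exp (\<epsilon> * (t + 1)) * \<rho> ^ n))
      \<longlonglongrightarrow> ennreal (exp \<epsilon> / (1 - \<rho>)) * (\<integral>\<^sup>+s. h s \<partial>lborel) + ennreal (c * exp (\<epsilon> * (t + 1)) * 0)"
    using \<rho>_nonneg \<rho>_less_1 by (intro tendsto_intros tendsto_ennrealI LIMSEQ_power_zero) auto
  from LIMSEQ_le_const[OF this] show ?thesis using le by auto
qed

end

section \<open>A renewal theorem for functions of controlled growth\<close>

lemma integrable_exp_atMost:
  fixes \<epsilon> T :: real
  assumes "0 < \<epsilon>"
  shows "integrable lborel (\<lambda>s. indicator {..T} s * exp (\<epsilon> * s))"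
proof -
  have "(\<integral>\<^sup>+x. ennreal (exp (- \<epsilon> * x)) * indicator {- T..} x \<partial>lborel) = ennreal (0 - (- exp (- \<epsilon> * - T) / \<epsilon>))"
  proof (rule nn_integral_FTC_atLeast)
    have "((\<lambda>x. exp (- \<epsilon> * x)) \<longlongrightarrow> 0) at_top"
      using assms by (intro filterlim_compose[OF exp_at_bot] filterlim_tendsto_neg_mult_at_bot[OF tendsto_const])
        (auto simp: filterlim_ident)
    from tendsto_divide[OF tendsto_minus[OF this] tendsto_const[of \<epsilon>]]
    show "((\<lambda>x. - exp (- \<epsilon> * x) / \<epsilon>) \<longlongrightarrow> 0) at_top"
      using assms by simp
  qed (use assms in \<open>auto intro!: derivative_eq_intros\<close>)
  moreover have "(\<integral>\<^sup>+s. ennreal (indicator {..T} s * exp (\<epsilon> * s)) \<partial>lborel)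
      = (\<integral>\<^sup>+x. ennreal (exp (- \<epsilon> * x)) * indicator {- T..} x \<partial>lborel)"
    by (subst nn_integral_real_affine[where c="-1" and t=0])
       (auto intro!: nn_integral_cong split: split_indicator)
  ultimately show ?thesis
    by (intro integrableI_nonneg) (auto simp: ennreal_less_top)
qed

text \<open>
The bound \<open>r_growth\<close> takes the place of direct Riemann integrability of \<open>g\<close>: it says that
\<open>e\<^bsup>-\<alpha>t\<^esup> r(t)\<close> is nonincreasing, and it makes pointwise values of \<open>r\<close> comparable with local averages.
The bound \<open>r_exp_bound\<close>, with the exponent of the contracted exponential function, makes the
remainder of the iterated renewal equation vanish; it excludes, for instance, adding a constant to \<open>r\<close>.
\<close>

locale additive_renewal = negative_exponential_moment +
  fixes r g :: "real \<Rightarrow> real" and \<alpha> c :: real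
  assumes r_measurable [measurable]: "r \<in> borel_measurable borel"
    and r_nonneg: "0 \<le> r t"
    and \<alpha>_nonneg: "0 \<le> \<alpha>"
    and r_growth: "0 \<le> s \<Longrightarrow> r (t + s) \<le> exp (\<alpha> * s) * r t"
    and r_exp_bound: "r t \<le> c * exp (\<epsilon> * t)"
    and g_integrable: "integrable lborel g"
    and renewal_equation: "r t = g t + (\<integral>u. r (t - u) \<partial>M)"
    and step_integrable: "integrable M (\<lambda>u. u)"
    and nonarith: "d > 0 \<Longrightarrow> emeasure M (UNIV - range (\<lambda>k::int. d * of_int k)) \<noteq> 0"
begin

lemma g_measurable [measurable]: "g \<in> borel_measurable borel"
  using borel_measurable_integrable[OF g_integrable] by simp

lemma c_nonneg: "0 \<le> c"
  using order_trans[OF r_nonneg r_exp_bound[of 0]] by simp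

lemma integrable_r_shift: "integrable M (\<lambda>u. r (t - u))"
proof (rule Bochner_Integration.integrable_bound)
  show "integrable M (\<lambda>u. (c * exp (\<epsilon> * t)) * exp (- \<epsilon> * u))"
    by (intro integrable_mult_right exp_integrable)
  have "r (t - u) \<le> (c * exp (\<epsilon> * t)) * exp (- \<epsilon> * u)" for u
    using r_exp_bound[of "t - u"] by (simp add: exp_add[symmetric] algebra_simps mult_exp_exp)
  then show "AE u in M. norm (r (t - u)) \<le> norm ((c * exp (\<epsilon> * t)) * exp (- \<epsilon> * u))"
    using r_nonneg c_nonneg by (auto simp: abs_mult)
qed simp

text \<open>
By the growth bound \<open>r(t)\<close> is at most \<open>e\<^sup>\<alpha>\<close> times its integral over \<open>[t - 1, t]\<close>.
\<close>

lemma r_bounded: "\<exists>B. \<forall>t. r t \<le> B"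
proof -
  define K where "K = ennreal (exp \<epsilon> / (1 - \<rho>)) * (\<integral>\<^sup>+s. ennreal \<bar>g s\<bar> \<partial>lborel)"
  have "K < \<top>"
    using g_integrable by (auto simp: K_def ennreal_mult_less_top integrable_iff_bounded)
  then obtain k where k: "K = ennreal k" "0 \<le> k" by (cases K) auto
  have sub: "ennreal (r t) \<le> ennreal \<bar>g t\<bar> + backward_mean (\<lambda>s. ennreal (r s)) t" for t
  proof -
    have "backward_mean (\<lambda>s. ennreal (r s)) t = ennreal (\<integral>u. r (t - u) \<partial>M)"
      unfolding backward_mean_def
      by (rule nn_integral_eq_integral) (use integrable_r_shift r_nonneg in auto)
    moreover have "0 \<le> (\<integral>u. r (t - u) \<partial>M)" by (simp add: r_nonneg)
    ultimately show ?thesis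
      using renewal_equation[of t] by (simp add: ennreal_plus[symmetric] del: ennreal_plus)
  qed
  have "r t \<le> exp \<alpha> * k" for t
  proof -
    have "ennreal (r t) = (\<integral>\<^sup>+s. ennreal (r t) * indicator {t-1..t-1+1} s \<partial>lborel)"
      by (simp add: nn_integral_cmult_indicator)
    also have "\<dots> \<le> (\<integral>\<^sup>+s. ennreal (exp \<alpha>) * (indicator {t-1..t-1+1} s * ennreal (r s)) \<partial>lborel)"
    proof (rule nn_integral_mono)
      fix s
      show "ennreal (r t) * indicator {t-1..t-1+1} s \<le> ennreal (exp \<alpha>) * (indicator {t-1..t-1+1} s * ennreal (r s))"
      proof (cases "s \<in> {t-1..t-1+1}")
        case True
        have "r t \<le> exp (\<alpha> * (t - s)) * r s" using r_growth[of "t - s" s] True by simp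
        also have "\<dots> \<le> exp \<alpha> * r s"
          using True \<alpha>_nonneg r_nonneg mult_left_mono[of "t - s" 1 \<alpha>] by (intro mult_right_mono) auto
        finally show ?thesis using True r_nonneg by (simp add: ennreal_mult[symmetric] ennreal_leI)
      qed simp
    qed
    also have "\<dots> = ennreal (exp \<alpha>) * (\<integral>\<^sup>+s. indicator {t-1..t-1+1} s * ennreal (r s) \<partial>lborel)"
      by (rule nn_integral_cmult) simp
    also have "\<dots> \<le> ennreal (exp \<alpha>) * K"
      unfolding K_def using sub r_exp_bound c_nonneg
      by (intro mult_left_mono unit_interval_integral_le[where c=c]) (auto intro!: ennreal_leI)
    also have "\<dots> = ennreal (exp \<alpha> * k)" by (simp add: k ennreal_mult)
    finally show ?thesis using k(2) by simp
  qed
  then show ?thesis by blast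
qed

definition cum :: "real \<Rightarrow> real" where
  "cum T = (\<integral>s. indicator {..T} s * r s \<partial>lborel)"

lemma integrable_r_atMost: "integrable lborel (\<lambda>s. indicator {..T} s * r s)"
proof (rule Bochner_Integration.integrable_bound)
  show "integrable lborel (\<lambda>s. c * (indicator {..T} s * exp (\<epsilon> * s)))"
    by (intro integrable_mult_right integrable_exp_atMost \<epsilon>_pos)
qed (use r_nonneg r_exp_bound c_nonneg in \<open>auto simp: abs_mult split: split_indicator\<close>)

lemma cum_diff:
  assumes "S \<le> T"
  shows "integrable lborel (\<lambda>s. indicator {S<..T} s * r s)"
    "cum T - cum S = (\<integral>s. indicator {S<..T} s * r s \<partial>lborel)"
proof -
  have eq: "indicator {S<..T} s * r s = indicator {..T} s * r s - indicator {..S} s * r s" for s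
    using assms by (auto split: split_indicator)
  show "integrable lborel (\<lambda>s. indicator {S<..T} s * r s)"
    unfolding eq by (intro Bochner_Integration.integrable_diff integrable_r_atMost)
  show "cum T - cum S = (\<integral>s. indicator {S<..T} s * r s \<partial>lborel)"
    unfolding eq cum_def by (subst Bochner_Integration.integral_diff) (simp_all add: integrable_r_atMost)
qed

lemma cum_diff_bounds:
  assumes "S \<le> T" and "\<And>s. S < s \<Longrightarrow> s \<le> T \<Longrightarrow> a \<le> r s" and "\<And>s. S < s \<Longrightarrow> s \<le> T \<Longrightarrow> r s \<le> b"
  shows "a * (T - S) \<le> cum T - cum S" "cum T - cum S \<le> b * (T - S)"
proof -
  have const: "integrable lborel (\<lambda>s. indicator {S<..T} s * k)" 
    "(\<integral>s. indicator {S<..T} s * k \<partial>lborel) = k * (T - S)" for k :: real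
    using assms(1) by (auto intro!: integrable_mult_left)
  have "(\<integral>s. indicator {S<..T} s * a \<partial>lborel) \<le> (\<integral>s. indicator {S<..T} s * r s \<partial>lborel)"
    by (intro integral_mono const cum_diff assms) (use assms in \<open>auto split: split_indicator\<close>)
  then show "a * (T - S) \<le> cum T - cum S" using const cum_diff assms(1) by (simp add: mult.commute)
  have "(\<integral>s. indicator {S<..T} s * r s \<partial>lborel) \<le> (\<integral>s. indicator {S<..T} s * b \<partial>lborel)"
    by (intro integral_mono const cum_diff assms) (use assms in \<open>auto split: split_indicator\<close>)
  then show "cum T - cum S \<le> b * (T - S)" using const cum_diff assms(1) by (simp add: mult.commute)
qed

lemma cum_lipschitz:
  assumes "\<And>t. r t \<le> B"
  shows "\<bar>cum s - cum t\<bar> \<le> B * \<bar>s - t\<bar>"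
  using cum_diff_bounds[of s t 0 B] cum_diff_bounds[of t s 0 B] assms r_nonneg
  by (cases "s \<le> t") auto

lemma cum_mono:
  assumes "s \<le> t"
  shows "cum s \<le> cum t"
proof -
  have "0 \<le> (\<integral>x. indicator {s<..t} x * r x \<partial>lborel)" using r_nonneg by simp
  then show ?thesis using cum_diff(2)[OF assms] by simp
qed

lemma measurable_cum [measurable]: "cum \<in> borel_measurable borel"
  by (rule borel_measurable_mono) (auto simp: mono_def cum_mono)

text \<open>
The renewal equation integrated over \<open>(-\<infinity>, T]\<close>.  It fixes the total mass and hence the value of the
limit; \<open>cum\<close> is finite because of the exponential bound on \<open>r\<close>.
\<close>

lemma cum_balance:
  shows "integrable M (\<lambda>u. cum (T - u))"
    and "(\<integral>u. cum T - cum (T - u) \<partial>M) = (\<integral>s. indicator {..T} s * g s \<partial>lborel)"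
proof -
  interpret P: pair_sigma_finite lborel M
    by (intro pair_sigma_finite.intro sigma_finite_lborel sigma_finite_measure_axioms)
  have sets: "sets (lborel \<Otimes>\<^sub>M M) = sets (borel \<Otimes>\<^sub>M (borel :: real measure))"
    by (rule sets_pair_measure_cong) auto
  have g_int: "integrable lborel (\<lambda>t. indicator {..T} t * g t)"
    using integrable_mult_indicator[OF _ g_integrable, of "{..T}"] by simp
  have inner: "(\<integral>u. r (t - u) \<partial>M) = r t - g t" for t
    using renewal_equation[of t] by simp
  have pair: "integrable (lborel \<Otimes>\<^sub>M M) (\<lambda>(t, u). indicator {..T} t * r (t - u))"
  proof (rule P.Fubini_integrable)
    show "(\<lambda>(t, u). indicator {..T} t * r (t - u)) \<in> borel_measurable (lborel \<Otimes>\<^sub>M M)"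
      by (subst measurable_cong_sets[OF sets refl]) measurable
    show "integrable lborel (\<lambda>t. \<integral>u. norm (case (t, u) of (t, u) \<Rightarrow> indicator {..T} t * r (t - u)) \<partial>M)"
      using integrable_r_atMost[of T] g_int r_nonneg by (simp add: abs_mult inner right_diff_distrib)
    show "AE t in lborel. integrable M (\<lambda>u. case (t, u) of (t, u) \<Rightarrow> indicator {..T} t * r (t - u))"
      using integrable_r_shift by (auto intro!: integrable_mult_right)
  qed
  have inner': "(\<integral>t. indicator {..T} t * r (t - u) \<partial>lborel) = cum (T - u)" for u
    unfolding cum_def
    by (subst lborel_integral_real_affine[where c=1 and t=u])
       (auto intro!: Bochner_Integration.integral_cong split: split_indicator)
  show int: "integrable M (\<lambda>u. cum (T - u))"
    using P.integrable_snd[OF pair] by (simp add: inner')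
  have "(\<integral>u. cum (T - u) \<partial>M) = (\<integral>t. \<integral>u. indicator {..T} t * r (t - u) \<partial>M \<partial>lborel)"
    using P.Fubini_integral[OF pair] by (simp add: inner')
  also have "\<dots> = cum T - (\<integral>s. indicator {..T} s * g s \<partial>lborel)"
    using integrable_r_atMost[of T] g_int by (simp add: inner cum_def right_diff_distrib)
  finally show "(\<integral>u. cum T - cum (T - u) \<partial>M) = (\<integral>s. indicator {..T} s * g s \<partial>lborel)"
    using int by simp
qed

lemma g_partial_integral_tendsto:
  "((\<lambda>T. \<integral>s. indicator {..T} s * g s \<partial>lborel) \<longlongrightarrow> (\<integral>s. g s \<partial>lborel)) at_top"
  using tendsto_integral_at_top[OF _ g_integrable] by simp

text \<open>
The integral of \<open>r\<close> over a window of length \<open>\<delta>\<close> fails to be harmonic only by an integral of \<open>g\<close> over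
that window, which tends to \<open>0\<close> because \<open>g\<close> is integrable.
\<close>

lemma window_increments_tendsto_0:
  assumes "0 \<le> \<delta>"
  shows "((\<lambda>t. (cum (t - a + \<delta>) - cum (t - a)) - (cum (t + \<delta>) - cum t)) \<longlongrightarrow> 0) at_top"
proof -
  obtain B where B: "\<And>t. r t \<le> B" using r_bounded by blast
  define \<phi> where "\<phi> t = cum (t + \<delta>) - cum t" for t
  define G where "G T = (\<integral>s. indicator {..T} s * g s \<partial>lborel)" for T
  have "((\<lambda>t. \<phi> (t - a) - \<phi> t) \<longlongrightarrow> 0) at_top"
  proof (rule lipschitz_increments_tendsto_0)
    show "\<phi> \<in> borel_measurable borel" unfolding \<phi>_def by measurable
    show "\<bar>\<phi> t\<bar> \<le> B * \<delta>" for t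
      using cum_lipschitz[OF B, of "t + \<delta>" t] assms by (simp add: \<phi>_def)
    show "\<bar>\<phi> s - \<phi> t\<bar> \<le> (2 * B) * \<bar>s - t\<bar>" for s t
      using cum_lipschitz[OF B, of "s + \<delta>" "t + \<delta>"] cum_lipschitz[OF B, of s t] by (simp add: \<phi>_def)
    have sm: "(\<integral>u. cum (T - u) \<partial>M) = cum T - G T" for T
      using cum_balance[of T] by (simp add: G_def)
    have "\<phi> t - shift_mean \<phi> t = G (t + \<delta>) - G t" for t
    proof -
      have "shift_mean \<phi> t = (\<integral>u. cum (t + \<delta> - u) - cum (t - u) \<partial>M)"
        by (simp add: shift_mean_def \<phi>_def algebra_simps)
      also have "\<dots> = (cum (t + \<delta>) - G (t + \<delta>)) - (cum t - G t)"
        by (simp add: cum_balance(1) sm)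
      finally show ?thesis by (simp add: \<phi>_def)
    qed
    moreover have "((\<lambda>t. G (t + \<delta>) - G t) \<longlongrightarrow> (\<integral>s. g s \<partial>lborel) - (\<integral>s. g s \<partial>lborel)) at_top"
      unfolding G_def
      by (intro tendsto_diff g_partial_integral_tendsto filterlim_compose[OF g_partial_integral_tendsto shift_at_top])
    ultimately show "((\<lambda>t. \<phi> t - shift_mean \<phi> t) \<longlongrightarrow> 0) at_top" by simp
  qed (rule nonarith)
  then show ?thesis by (simp add: \<phi>_def)
qed

text \<open>
Over a window of length \<open>\<delta>\<close> the growth bound squeezes \<open>r\<close> between its window averages up to the factor
\<open>q = e\<^bsup>\<alpha>\<delta>\<^esup>\<close>.  Boundedness makes the error \<open>(q - 1/q) B\<close> small when \<open>\<delta>\<close> is small.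
\<close>

lemma r_increments_eventually_less:
  assumes "0 < e"
  shows "\<forall>\<^sub>F t in at_top. r (t + x) - r t < e"
proof -
  obtain B where B: "\<And>t. r t \<le> B" using r_bounded by blast
  have "((\<lambda>\<delta>. (exp (\<alpha> * \<delta>) - exp (- (\<alpha> * \<delta>))) * B) \<longlongrightarrow> (exp (\<alpha> * 0) - exp (- (\<alpha> * 0))) * B) (at_right 0)"
    by (intro tendsto_intros)
  then have "\<forall>\<^sub>F \<delta> in at_right 0. (exp (\<alpha> * \<delta>) - exp (- (\<alpha> * \<delta>))) * B < e / 2"
    using assms by (intro order_tendstoD) auto
  then have "\<forall>\<^sub>F \<delta> in at_right 0. (exp (\<alpha> * \<delta>) - exp (- (\<alpha> * \<delta>))) * B < e / 2 \<and> 0 < \<delta>"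
    by (auto intro: eventually_conj simp: eventually_at_right_less)
  then obtain \<delta> where \<delta>: "(exp (\<alpha> * \<delta>) - exp (- (\<alpha> * \<delta>))) * B < e / 2" "0 < \<delta>"
    using eventually_happens'[OF trivial_limit_at_right_real] by blast
  define q where "q = exp (\<alpha> * \<delta>)"
  have q: "1 \<le> q" "exp (- (\<alpha> * \<delta>)) = 1 / q" "(q - 1 / q) * B < e / 2"
    using \<delta> \<alpha>_nonneg by (auto simp: q_def exp_minus inverse_eq_divide)
  define \<phi> where "\<phi> t = (cum (t + \<delta>) - cum t) / \<delta>" for t
  have upper: "r (t + \<delta>) \<le> q * \<phi> t" and lower: "\<phi> t \<le> q * r t" for t
  proof -
    have lo: "r (t + \<delta>) / q \<le> r s" if "t < s" "s \<le> t + \<delta>" for s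
    proof -
      have "r (t + \<delta>) \<le> exp (\<alpha> * (t + \<delta> - s)) * r s" using r_growth[of "t + \<delta> - s" s] that by simp
      also have "\<dots> \<le> q * r s"
        unfolding q_def using that \<alpha>_nonneg r_nonneg mult_left_mono[of "t + \<delta> - s" \<delta> \<alpha>]
        by (intro mult_right_mono) auto
      finally show ?thesis using q by (simp add: field_simps)
    qed
    have hi: "r s \<le> q * r t" if "t < s" "s \<le> t + \<delta>" for s
    proof -
      have "r s \<le> exp (\<alpha> * (s - t)) * r t" using r_growth[of "s - t" t] that by simp
      also have "\<dots> \<le> q * r t"
        unfolding q_def using that \<alpha>_nonneg r_nonneg mult_left_mono[of "s - t" \<delta> \<alpha>]
        by (intro mult_right_mono) auto
      finally show ?thesis .
    qed
    have "r (t + \<delta>) / q * (t + \<delta> - t) \<le> cum (t + \<delta>) - cum t"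
      "cum (t + \<delta>) - cum t \<le> q * r t * (t + \<delta> - t)"
      using \<delta>(2) cum_diff_bounds[of t "t + \<delta>", OF _ lo hi] by simp_all
    then show "r (t + \<delta>) \<le> q * \<phi> t" "\<phi> t \<le> q * r t"
      using \<delta>(2) q(1) by (auto simp: \<phi>_def field_simps)
  qed
  have \<phi>B: "\<phi> t \<le> B" for t
    using cum_lipschitz[OF B, of "t + \<delta>" t] \<delta>(2) by (simp add: \<phi>_def field_simps abs_le_iff)
  have "((\<lambda>t. q / \<delta> * ((cum (t - (\<delta> - x) + \<delta>) - cum (t - (\<delta> - x))) - (cum (t + \<delta>) - cum t))) \<longlongrightarrow> q / \<delta> * 0) at_top"
    using \<delta>(2) by (intro tendsto_mult_left window_increments_tendsto_0) simp
  then have "((\<lambda>t. q * (\<phi> (t + x - \<delta>) - \<phi> t)) \<longlongrightarrow> 0) at_top"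
    using \<delta>(2) by (simp add: \<phi>_def diff_divide_distrib algebra_simps)
  then have "\<forall>\<^sub>F t in at_top. q * (\<phi> (t + x - \<delta>) - \<phi> t) < e / 2"
    using assms by (intro order_tendstoD) auto
  then show ?thesis
  proof eventually_elim
    case (elim t)
    have "r (t + x) \<le> q * \<phi> (t + x - \<delta>)" using upper[of "t + x - \<delta>"] by simp
    moreover have "\<phi> t / q \<le> r t" using lower[of t] q(1) by (simp add: field_simps)
    ultimately have "r (t + x) - r t \<le> q * (\<phi> (t + x - \<delta>) - \<phi> t) + (q - 1 / q) * \<phi> t"
      by (simp add: algebra_simps)
    moreover have "1 / q \<le> q" using q(1) by (smt (verit) divide_le_eq_1)
    then have "(q - 1 / q) * \<phi> t \<le> (q - 1 / q) * B"
      by (intro mult_left_mono \<phi>B) simp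
    ultimately show ?case using elim q(3) by linarith
  qed
qed

lemma r_increments_tendsto_0: "((\<lambda>t. r (t - a) - r t) \<longlongrightarrow> 0) at_top"
proof (rule tendstoI)
  fix e :: real assume "0 < e"
  have "\<forall>\<^sub>F t in at_top. r (t - a + a) - r (t - a) < e"
    using r_increments_eventually_less[OF \<open>0 < e\<close>, of a] shift_at_top[of "-a"]
    by (auto simp: filterlim_iff)
  moreover have "\<forall>\<^sub>F t in at_top. r (t + - a) - r t < e"
    by (rule r_increments_eventually_less) fact
  ultimately show "\<forall>\<^sub>F t in at_top. dist (r (t - a) - r t) 0 < e"
    by eventually_elim (simp add: dist_real_def)
qed

text \<open>
On the interval between \<open>T - u\<close> and \<open>T\<close> the function \<open>r\<close> differs from \<open>r(T)\<close> by a bounded quantity that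
tends to \<open>0\<close> pointwise.
\<close>

lemma cum_increment_asymp_nonneg:
  assumes "0 \<le> u"
  shows "((\<lambda>T. cum T - cum (T - u) - u * r T) \<longlongrightarrow> 0) at_top"
proof -
  obtain B where B: "\<And>t. r t \<le> B" using r_bounded by blast
  have B0: "0 \<le> B" using order_trans[OF r_nonneg B] .
  have eq: "cum T - cum (T - u) - u * r T = (\<integral>x. indicator {0..<u} x * (r (T - x) - r T) \<partial>lborel)" for T
  proof -
    have eq1: "indicator {T - u<..T} (T - x) = (indicator {0..<u} x :: real)" for x
      by (auto split: split_indicator)
    have "integrable lborel (\<lambda>x. indicator {0..<u} x * r (T - x))"
      using lborel_integrable_real_affine[OF cum_diff(1)[of "T - u" T], of "-1" T] assms by (simp add: eq1)
    moreover have "cum T - cum (T - u) = (\<integral>x. indicator {0..<u} x * r (T - x) \<partial>lborel)"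
      using assms by (subst cum_diff(2)[of "T-u" T], simp, subst lborel_integral_real_affine[where c="-1" and t=T])
        (simp_all add: eq1)
    moreover have "integrable lborel (\<lambda>x. indicator {0..<u} x * r T)"
      using assms by (intro integrable_mult_left) auto
    ultimately show ?thesis
      using assms by (simp add: right_diff_distrib)
  qed
  have "((\<lambda>T. \<integral>x. indicator {0..<u} x * (r (T - x) - r T) \<partial>lborel) \<longlongrightarrow> integral\<^sup>L lborel (\<lambda>x :: real. 0)) at_top"
  proof (rule integral_dominated_convergence_at_top[where w="\<lambda>x. indicator {0..<u} x * B"])
    show "integrable lborel (\<lambda>x. indicator {0..<u} x * B)"
      using assms by (intro integrable_mult_left) auto
    have "\<bar>r (T - x) - r T\<bar> \<le> B" for T x
      using B[of "T - x"] B[of T] r_nonneg[of "T - x"] r_nonneg[of T] by linarith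
    then show "\<forall>\<^sub>F T in at_top. AE x in lborel. norm (indicator {0..<u} x * (r (T - x) - r T)) \<le> indicator {0..<u} x * B"
      by (auto split: split_indicator)
    show "AE x in lborel. ((\<lambda>T. indicator {0..<u} x * (r (T - x) - r T)) \<longlongrightarrow> 0) at_top"
      by (intro AE_I2 tendsto_mult_right_zero r_increments_tendsto_0)
  qed auto
  then show ?thesis by (simp add: eq)
qed

text \<open>
For a negative \<open>u\<close> the roles of the two endpoints are exchanged, and \<open>r(T)\<close> at the new endpoint is
corrected by slow variation.
\<close>

lemma cum_increment_asymp: "((\<lambda>T. cum T - cum (T - u) - u * r T) \<longlongrightarrow> 0) at_top"
proof (cases "0 \<le> u")
  case True then show ?thesis by (rule cum_increment_asymp_nonneg)
next
  case False
  have "((\<lambda>T. - (cum (T + - u) - cum (T + - u - - u) - - u * r (T + - u)) + u * (r (T - u) - r T)) \<longlongrightarrow> - 0 + u * 0) at_top"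
    using False by (intro tendsto_intros r_increments_tendsto_0
      filterlim_compose[OF cum_increment_asymp_nonneg shift_at_top]) simp
  then show ?thesis by (simp add: algebra_simps)
qed

text \<open>
In the balance equation the integrand is \<open>u r(T) + o(1)\<close> and is dominated by a multiple of \<open>|u|\<close>, so the
balance becomes \<open>\<mu> r(T) \<longlongrightarrow> \<integral>g\<close>.
\<close>

theorem renewal_limit:
  assumes "(\<integral>u. u \<partial>M) \<noteq> 0"
  shows "(r \<longlongrightarrow> (\<integral>t. g t \<partial>lborel) / (\<integral>u. u \<partial>M)) at_top"
proof -
  define m where "m = (\<integral>u. u \<partial>M)"
  obtain B where B: "\<And>t. r t \<le> B" using r_bounded by blast
  have B0: "0 \<le> B" using order_trans[OF r_nonneg B] .
  have "((\<lambda>T. \<integral>u. cum T - cum (T - u) - u * r T \<partial>M) \<longlongrightarrow> (\<integral>u. 0 \<partial>M)) at_top"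
  proof (rule integral_dominated_convergence_at_top[where w="\<lambda>u. 2 * B * \<bar>u\<bar>"])
    show "integrable M (\<lambda>u. 2 * B * \<bar>u\<bar>)"
      using step_integrable by (intro integrable_mult_right integrable_abs)
    have "\<bar>cum T - cum (T - u) - u * r T\<bar> \<le> 2 * B * \<bar>u\<bar>" for T u
    proof -
      have "\<bar>u * r T\<bar> \<le> \<bar>u\<bar> * B" using B[of T] r_nonneg[of T] by (simp add: abs_mult mult_left_mono)
      then show ?thesis using cum_lipschitz[OF B, of T "T - u"] by (simp add: abs_le_iff algebra_simps)
    qed
    then show "\<forall>\<^sub>F T in at_top. AE u in M. norm (cum T - cum (T - u) - u * r T) \<le> 2 * B * \<bar>u\<bar>"
      by simp
  qed (use cum_increment_asymp in auto)
  moreover have "(\<integral>u. cum T - cum (T - u) - u * r T \<partial>M) = (\<integral>s. indicator {..T} s * g s \<partial>lborel) - m * r T" for T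
    using cum_balance[of T] step_integrable by (simp add: m_def)
  ultimately have "((\<lambda>T. (\<integral>s. indicator {..T} s * g s \<partial>lborel) - m * r T) \<longlongrightarrow> 0) at_top" by simp
  from tendsto_diff[OF g_partial_integral_tendsto this]
  have "((\<lambda>T. m * r T) \<longlongrightarrow> (\<integral>t. g t \<partial>lborel)) at_top" by simp
  from tendsto_divide[OF this tendsto_const[of m]] assms show ?thesis
    by (simp add: m_def)
qed

end

section \<open>Exponential moments and exponential substitution\<close>

lemma le_exp_divide:
  fixes y \<kappa> :: real assumes "0 < \<kappa>" shows "y \<le> exp (\<kappa> * y) / \<kappa>"
proof -
  have "\<kappa> * y \<le> exp (\<kappa> * y)" using exp_ge_add_one_self[of "\<kappa> * y"] by linarith
  then show ?thesis using assms by (simp add: field_simps)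
qed

text \<open>
The Laplace transform equals \<open>1\<close> at \<open>0\<close> and has there the derivative \<open>- E u < 0\<close>.
\<close>

lemma (in real_distribution) exists_exponential_moment_less_1:
  assumes "integrable M (\<lambda>u. u)" "0 < (\<integral>u. u \<partial>M)" "0 < \<kappa>\<^sub>0"
    and exp0: "integrable M (\<lambda>u. exp (- \<kappa>\<^sub>0 * u))"
  shows "\<exists>\<kappa>. 0 < \<kappa> \<and> \<kappa> < \<kappa>\<^sub>0 \<and> integrable M (\<lambda>u. exp (- \<kappa> * u)) \<and> (\<integral>u. exp (- \<kappa> * u) \<partial>M) < 1"
proof -
  \<comment> \<open>Staying below \<open>\<kappa>\<^sub>0 / 2\<close> leaves a factor \<open>exp (\<kappa>\<^sub>0 y / 2)\<close> to dominate the difference quotient.\<close>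
  define \<kappa> where "\<kappa> n = \<kappa>\<^sub>0 / (real n + 2)" for n
  have \<kappa>: "0 < \<kappa> n" "\<kappa> n \<le> \<kappa>\<^sub>0 / 2" for n
    using \<open>0 < \<kappa>\<^sub>0\<close> by (auto simp: \<kappa>_def field_simps)
  have int: "integrable M (\<lambda>u. exp (- \<kappa> n * u))" for n
  proof (rule Bochner_Integration.integrable_bound)
    show "integrable M (\<lambda>u. 1 + exp (- \<kappa>\<^sub>0 * u))" using exp0 by simp
    have "exp (- \<kappa> n * u) \<le> 1 + exp (- \<kappa>\<^sub>0 * u)" for u
    proof (cases "0 \<le> u")
      case True
      then have "exp (- \<kappa> n * u) \<le> 1" using \<kappa>(1)[of n] by simp
      then show ?thesis using exp_ge_zero[of "- \<kappa>\<^sub>0 * u"] by linarith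
    next
      case False
      have "\<kappa>\<^sub>0 * u \<le> \<kappa> n * u" using False \<kappa>[of n] \<open>0 < \<kappa>\<^sub>0\<close> by (intro mult_right_mono_neg) auto
      then have "exp (- \<kappa> n * u) \<le> exp (- \<kappa>\<^sub>0 * u)" by simp
      then show ?thesis by linarith
    qed
    then show "AE u in M. norm (exp (- \<kappa> n * u)) \<le> norm (1 + exp (- \<kappa>\<^sub>0 * u))" by auto
  qed simp
  have "(\<lambda>n. \<integral>u. (1 - exp (- \<kappa> n * u)) / \<kappa> n \<partial>M) \<longlonglongrightarrow> (\<integral>u. u \<partial>M)"
  proof (rule integral_dominated_convergence[where w="\<lambda>u. \<bar>u\<bar> + (2 / \<kappa>\<^sub>0) * exp (- \<kappa>\<^sub>0 * u)"])
    show "integrable M (\<lambda>u. \<bar>u\<bar> + (2 / \<kappa>\<^sub>0) * exp (- \<kappa>\<^sub>0 * u))"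
      using assms by (intro Bochner_Integration.integrable_add integrable_mult_right integrable_abs)
    show "AE u in M. (\<lambda>n. (1 - exp (- \<kappa> n * u)) / \<kappa> n) \<longlonglongrightarrow> u"
    proof (rule AE_I2)
      fix u
      have "((\<lambda>x. 1 - exp (- x * u)) has_real_derivative u) (at 0)"
        by (auto intro!: derivative_eq_intros)
      then have "((\<lambda>x. (1 - exp (- x * u)) / x) \<longlongrightarrow> u) (at 0)"
        by (simp add: has_field_derivative_iff)
      moreover have "filterlim \<kappa> (at 0) sequentially"
      proof (rule filterlim_atI)
        show "\<kappa> \<longlonglongrightarrow> 0"
          using LIMSEQ_ignore_initial_segment[OF lim_const_over_n[of \<kappa>\<^sub>0], of 2] by (simp add: \<kappa>_def[abs_def] add.commute)
      qed (use \<kappa>(1) in \<open>auto intro!: always_eventually simp: less_imp_neq[symmetric]\<close>)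
      ultimately show "(\<lambda>n. (1 - exp (- \<kappa> n * u)) / \<kappa> n) \<longlonglongrightarrow> u" by (rule filterlim_compose)
    qed
    have "\<bar>(1 - exp (- \<kappa> n * u)) / \<kappa> n\<bar> \<le> \<bar>u\<bar> + (2 / \<kappa>\<^sub>0) * exp (- \<kappa>\<^sub>0 * u)" for n u
    proof (cases "0 \<le> u")
      case True
      have "1 - exp (- \<kappa> n * u) \<le> \<kappa> n * u" using exp_ge_add_one_self[of "- \<kappa> n * u"] by linarith
      then have "(1 - exp (- \<kappa> n * u)) / \<kappa> n \<le> u" using \<kappa>(1)[of n] by (simp add: field_simps)
      moreover have "0 \<le> (1 - exp (- \<kappa> n * u)) / \<kappa> n" using True \<kappa>(1)[of n] by simp
      moreover have "0 \<le> (2 / \<kappa>\<^sub>0) * exp (- \<kappa>\<^sub>0 * u)" using \<open>0 < \<kappa>\<^sub>0\<close> by simp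
      ultimately show ?thesis using True by linarith
    next
      case False
      define y where "y = - u"
      have y: "0 < y" using False by (simp add: y_def)
      have "exp (\<kappa> n * y) - 1 = exp (\<kappa> n * y) * (1 - exp (- (\<kappa> n * y)))"
        by (simp add: right_diff_distrib exp_minus)
      also have "\<dots> \<le> exp (\<kappa> n * y) * (\<kappa> n * y)"
        using exp_ge_add_one_self[of "- (\<kappa> n * y)"] by (intro mult_left_mono) auto
      finally have "(exp (\<kappa> n * y) - 1) / \<kappa> n \<le> exp (\<kappa> n * y) * y"
        using \<kappa>(1)[of n] by (simp add: field_simps)
      also have "\<dots> \<le> exp (\<kappa>\<^sub>0 / 2 * y) * (exp (\<kappa>\<^sub>0 / 2 * y) / (\<kappa>\<^sub>0 / 2))"
      proof (rule mult_mono)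
        show "exp (\<kappa> n * y) \<le> exp (\<kappa>\<^sub>0 / 2 * y)"
          using mult_right_mono[OF \<kappa>(2)[of n], of y] y by simp
        show "y \<le> exp (\<kappa>\<^sub>0 / 2 * y) / (\<kappa>\<^sub>0 / 2)"
          by (rule le_exp_divide) (use \<open>0 < \<kappa>\<^sub>0\<close> in simp)
      qed (use y in auto)
      also have "\<dots> = (2 / \<kappa>\<^sub>0) * exp (\<kappa>\<^sub>0 * y)" by (simp add: exp_add[symmetric] mult_exp_exp)
      finally have "(exp (\<kappa> n * y) - 1) / \<kappa> n \<le> (2 / \<kappa>\<^sub>0) * exp (\<kappa>\<^sub>0 * y)" .
      moreover have "0 \<le> (exp (\<kappa> n * y) - 1) / \<kappa> n" using y \<kappa>(1)[of n] by simp
      moreover have "(1 - exp (- \<kappa> n * u)) / \<kappa> n = - ((exp (\<kappa> n * y) - 1) / \<kappa> n)"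
        by (simp add: y_def minus_divide_left)
      ultimately show ?thesis by (simp add: y_def)
    qed
    then show "AE u in M. norm ((1 - exp (- \<kappa> n * u)) / \<kappa> n) \<le> \<bar>u\<bar> + (2 / \<kappa>\<^sub>0) * exp (- \<kappa>\<^sub>0 * u)" for n
      by simp
  qed simp_all
  then have "\<forall>\<^sub>F n in sequentially. 0 < (\<integral>u. (1 - exp (- \<kappa> n * u)) / \<kappa> n \<partial>M)"
    using assms(2) by (rule order_tendstoD)
  then obtain n where n: "0 < (\<integral>u. (1 - exp (- \<kappa> n * u)) / \<kappa> n \<partial>M)"
    using eventually_happens'[OF sequentially_bot] by blast
  have "(\<integral>u. (1 - exp (- \<kappa> n * u)) / \<kappa> n \<partial>M) = (1 - (\<integral>u. exp (- \<kappa> n * u) \<partial>M)) / \<kappa> n"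
    using int[of n] by simp
  then have "(\<integral>u. exp (- \<kappa> n * u) \<partial>M) < 1"
    using n \<kappa>(1)[of n] by (simp add: zero_less_divide_iff)
  moreover have "\<kappa> n < \<kappa>\<^sub>0" using \<kappa>(2)[of n] \<open>0 < \<kappa>\<^sub>0\<close> by simp
  ultimately show ?thesis using int \<kappa>(1) by blast
qed

lemma integral_exp_substitution:
  fixes g :: "real \<Rightarrow> real"
  assumes [measurable]: "g \<in> borel_measurable borel"
    and int: "set_integrable lborel {0<..} (\<lambda>v. g (ln v) / v)"
  shows "integrable lborel g" "(LINT v:{0<..}|lborel. g (ln v) / v) = (\<integral>t. g t \<partial>lborel)"
proof -
  let ?f = "\<lambda>v. g (ln v) / v"
  have f: "?f absolutely_integrable_on {0<..}"
    using int unfolding set_integrable_def by (subst integrable_completion) auto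
  have range: "range exp = {0 :: real<..}"
  proof -
    have "v \<in> range exp" if "0 < v" for v :: real
      using that exp_ln[of v] by (metis rangeI)
    then show ?thesis by auto
  qed
  have der: "(exp has_field_derivative exp x) (at x within UNIV)" for x :: real
    by (auto intro!: derivative_eq_intros)
  have "(\<lambda>x. \<bar>exp x\<bar> * ?f (exp x)) absolutely_integrable_on UNIV \<and>
      integral UNIV (\<lambda>x. \<bar>exp x\<bar> * ?f (exp x)) = integral {0<..} ?f"
    using f by (subst has_absolute_integral_change_of_variables_1'[where g=exp and g'=exp]) (auto simp: range der inj_on_def)
  then have g: "g absolutely_integrable_on UNIV" "integral UNIV g = integral {0<..} ?f"
    by simp_all
  then have "integrable lebesgue g" by (simp add: set_integrable_def)
  then show "integrable lborel g" by (subst (asm) integrable_completion) auto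
  have "(LINT v:{0<..}|lborel. ?f v) = (LINT v:{0<..}|lebesgue. ?f v)"
    unfolding set_lebesgue_integral_def by (subst integral_completion) auto
  also have "\<dots> = integral {0<..} ?f" by (rule set_lebesgue_integral_eq_integral(2)[OF f])
  also have "\<dots> = (LINT v:UNIV|lebesgue. g v)"
    using g by (simp add: set_lebesgue_integral_eq_integral(2))
  also have "\<dots> = (\<integral>t. g t \<partial>lborel)"
    by (simp add: set_lebesgue_integral_def integral_completion)
  finally show "(LINT v:{0<..}|lborel. ?f v) = (\<integral>t. g t \<partial>lborel)" .
qed

section \<open>The tilted step distribution of a sequence of weights\<close>

locale weight_sequence = prob_space M for M :: "'a measure" +
  fixes Z :: "nat \<Rightarrow> 'a \<Rightarrow> real" and \<alpha> :: real
  assumes Z_measurable [measurable]: "\<And>j. Z j \<in> borel_measurable M"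
    and Z_nonneg: "\<And>j \<omega>. 0 \<le> Z j \<omega>"
    and \<alpha>_pos: "0 < \<alpha>"
    and total_weight: "(\<integral>\<^sup>+\<omega>. (\<Sum>j. ennreal (Z j \<omega> powr \<alpha>)) \<partial>M) = 1"
begin

text \<open>
The measure \<open>\<eta>(A) = E[\<Sum>\<^sub>j Z\<^sub>j\<^sup>\<alpha> 1(log Z\<^sub>j \<in> A)]\<close>, written as an image of a density on pairs of an index and
an outcome so that sums over the index are integrals.  A vanishing weight has density \<open>0\<close>, in
accordance with the convention \<open>0\<^sup>\<alpha> log 0 = 0\<close>.
\<close>

definition tilted :: "real measure" where
  "tilted = distr (density (count_space UNIV \<Otimes>\<^sub>M M) (\<lambda>(j, \<omega>). ennreal (Z j \<omega> powr \<alpha>)))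
     borel (\<lambda>(j, \<omega>). ln (Z j \<omega>))"

lemma Z_pair_measurable [measurable]:
  "(\<lambda>x. Z (fst x) (snd x)) \<in> borel_measurable (count_space UNIV \<Otimes>\<^sub>M M)"
  by (rule measurable_pair_measure_countable1) auto

lemma sets_tilted [simp]: "sets tilted = sets borel"
  by (simp add: tilted_def)

lemma nn_integral_pair:
  assumes [measurable]: "f \<in> borel_measurable (count_space UNIV \<Otimes>\<^sub>M M)"
  shows "(\<integral>\<^sup>+x. f x \<partial>(count_space UNIV \<Otimes>\<^sub>M M)) = (\<integral>\<^sup>+\<omega>. (\<Sum>j::nat. f (j, \<omega>)) \<partial>M)"
proof -
  have [measurable]: "(\<lambda>\<omega>. f (j, \<omega>)) \<in> borel_measurable M" for j by measurable
  show ?thesis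
    by (subst nn_integral_fst[symmetric]) (simp_all add: nn_integral_count_space_nat nn_integral_suminf)
qed

lemma nn_integral_tilted:
  assumes [measurable]: "f \<in> borel_measurable borel"
  shows "(\<integral>\<^sup>+u. f u \<partial>tilted) = (\<integral>\<^sup>+\<omega>. (\<Sum>j. ennreal (Z j \<omega> powr \<alpha>) * f (ln (Z j \<omega>))) \<partial>M)"
proof -
  have "(\<integral>\<^sup>+u. f u \<partial>tilted)
      = (\<integral>\<^sup>+x. ennreal (Z (fst x) (snd x) powr \<alpha>) * f (ln (Z (fst x) (snd x))) \<partial>(count_space UNIV \<Otimes>\<^sub>M M))"
    unfolding tilted_def case_prod_beta
    by (subst nn_integral_distr, measurable, subst nn_integral_density, measurable)
  also have "\<dots> = (\<integral>\<^sup>+\<omega>. (\<Sum>j. ennreal (Z j \<omega> powr \<alpha>) * f (ln (Z j \<omega>))) \<partial>M)"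
    by (subst nn_integral_pair) simp_all
  finally show ?thesis .
qed

sublocale T: real_distribution tilted
proof (intro real_distribution.intro real_distribution_axioms.intro prob_spaceI)
  show "emeasure tilted (space tilted) = 1"
    using nn_integral_tilted[of "\<lambda>_. 1"] by (simp only: nn_integral_const mult_1_right mult_1_left total_weight borel_measurable_const)
qed (rule sets_tilted)

lemma nn_integral_tilted_exp:
  "(\<integral>\<^sup>+u. ennreal (exp (- \<kappa> * u)) \<partial>tilted) = (\<integral>\<^sup>+\<omega>. (\<Sum>j. ennreal (Z j \<omega> powr (\<alpha> - \<kappa>))) \<partial>M)"
proof -
  have "ennreal (Z j \<omega> powr \<alpha>) * ennreal (exp (- \<kappa> * ln (Z j \<omega>))) = ennreal (Z j \<omega> powr (\<alpha> - \<kappa>))" for j \<omega>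
    using Z_nonneg[of j \<omega>]
    by (simp add: ennreal_mult[symmetric]) (simp add: powr_def exp_add[symmetric] algebra_simps mult_exp_exp)
  then show ?thesis by (simp add: nn_integral_tilted)
qed

lemma integral_tilted:
  assumes f: "integrable tilted f"
  shows "AE \<omega> in M. summable (\<lambda>j. \<bar>Z j \<omega> powr \<alpha> * f (ln (Z j \<omega>))\<bar>)"
    and "(\<integral>u. f u \<partial>tilted) = (\<integral>\<omega>. (\<Sum>j. Z j \<omega> powr \<alpha> * f (ln (Z j \<omega>))) \<partial>M)"
proof -
  have [measurable]: "f \<in> borel_measurable borel" using borel_measurable_integrable[OF f] by simp
  interpret P: pair_sigma_finite "count_space (UNIV :: nat set)" M
    by (intro pair_sigma_finite.intro sigma_finite_measure_count_space sigma_finite_measure_axioms)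
  let ?h = "\<lambda>(j, \<omega>). Z j \<omega> powr \<alpha> * f (ln (Z j \<omega>))"
  have h: "integrable (count_space UNIV \<Otimes>\<^sub>M M) ?h"
    using f unfolding tilted_def case_prod_beta
    by (subst (asm) integrable_distr_eq, simp, simp, subst (asm) integrable_density) simp_all
  show "AE \<omega> in M. summable (\<lambda>j. \<bar>Z j \<omega> powr \<alpha> * f (ln (Z j \<omega>))\<bar>)"
    using P.AE_integrable_snd[OF h] by eventually_elim (simp add: integrable_count_space_nat_iff)
  have "(\<integral>u. f u \<partial>tilted) = (\<integral>x. ?h x \<partial>(count_space UNIV \<Otimes>\<^sub>M M))"
    unfolding tilted_def case_prod_beta
    by (subst integral_distr, simp, simp, subst integral_density) simp_all
  also have "\<dots> = (\<integral>\<omega>. (\<integral>j. Z j \<omega> powr \<alpha> * f (ln (Z j \<omega>)) \<partial>count_space UNIV) \<partial>M)"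
    using P.integral_snd[OF h] by simp
  also have "\<dots> = (\<integral>\<omega>. (\<Sum>j. Z j \<omega> powr \<alpha> * f (ln (Z j \<omega>))) \<partial>M)"
    by (rule integral_cong_AE; (measurable)?)
       (use P.AE_integrable_snd[OF h] in \<open>eventually_elim, simp add: integral_count_space_nat\<close>)
  finally show "(\<integral>u. f u \<partial>tilted) = (\<integral>\<omega>. (\<Sum>j. Z j \<omega> powr \<alpha> * f (ln (Z j \<omega>))) \<partial>M)" .
qed

end

context weight_sequence
begin

lemma tilted_exp_integrable:
  assumes "(\<integral>\<^sup>+\<omega>. (\<Sum>j. ennreal (Z j \<omega> powr (\<alpha> - \<kappa>))) \<partial>M) < \<infinity>"
  shows "integrable tilted (\<lambda>u. exp (- \<kappa> * u))"
  by (rule integrableI_nonneg) (use assms nn_integral_tilted_exp[of \<kappa>] in auto)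

text \<open>
The negative part is dominated by the moment of order \<open>\<alpha> - \<kappa>\<close>.  Almost surely only finitely many weights
exceed \<open>1\<close>, because \<open>\<Sum>\<^sub>j Z\<^sub>j\<^sup>\<alpha>\<close> converges; so the series \<open>\<Sum>\<^sub>j Z\<^sub>j\<^sup>\<alpha> ln Z\<^sub>j\<close> converges absolutely, and its
positive part is integrable as the sum of the series and of the negative part.
\<close>

lemma tilted_step_integrable:
  assumes \<kappa>: "0 < \<kappa>" "(\<integral>\<^sup>+\<omega>. (\<Sum>j. ennreal (Z j \<omega> powr (\<alpha> - \<kappa>))) \<partial>M) < \<infinity>"
    and log_sum: "integrable M (\<lambda>\<omega>. \<Sum>j. Z j \<omega> powr \<alpha> * ln (Z j \<omega>))"
  shows "integrable tilted (\<lambda>u. u)"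
proof -
  let ?L = "\<lambda>\<omega>. \<Sum>j. Z j \<omega> powr \<alpha> * ln (Z j \<omega>)"
  let ?p = "\<lambda>\<omega> j. Z j \<omega> powr \<alpha> * max 0 (ln (Z j \<omega>))" and ?n = "\<lambda>\<omega> j. Z j \<omega> powr \<alpha> * max 0 (- ln (Z j \<omega>))"
  have neg: "integrable tilted (\<lambda>u. max 0 (- u))"
  proof (rule Bochner_Integration.integrable_bound)
    show "integrable tilted (\<lambda>u. exp (- \<kappa> * u) / \<kappa>)"
      by (intro integrable_divide_zero impI tilted_exp_integrable \<kappa>)
    have "max 0 (- u) \<le> exp (- \<kappa> * u) / \<kappa>" for u
      using le_exp_divide[OF \<kappa>(1), of "- u"] \<kappa>(1) by simp
    then show "AE u in tilted. norm (max 0 (- u)) \<le> norm (exp (- \<kappa> * u) / \<kappa>)"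
      using \<kappa>(1) by simp
  qed simp
  have n_fin: "(\<integral>\<^sup>+\<omega>. (\<Sum>j. ennreal (?n \<omega> j)) \<partial>M) < \<infinity>"
  proof -
    have "(\<integral>\<^sup>+u. ennreal (max 0 (- u)) \<partial>tilted) = (\<integral>\<^sup>+\<omega>. (\<Sum>j. ennreal (?n \<omega> j)) \<partial>M)"
      by (subst nn_integral_tilted) (simp_all add: ennreal_mult)
    then show ?thesis using neg by (auto simp: integrable_iff_bounded)
  qed
  have "(\<integral>\<^sup>+\<omega>. (\<Sum>j. ennreal (?p \<omega> j)) \<partial>M) \<le> (\<integral>\<^sup>+\<omega>. ennreal \<bar>?L \<omega>\<bar> + (\<Sum>j. ennreal (?n \<omega> j)) \<partial>M)"
  proof (rule nn_integral_mono_AE)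
    have "AE \<omega> in M. (\<Sum>j. ennreal (Z j \<omega> powr \<alpha>)) \<noteq> \<infinity>"
      by (rule nn_integral_PInf_AE) (use total_weight in auto)
    moreover have "AE \<omega> in M. (\<Sum>j. ennreal (?n \<omega> j)) \<noteq> \<infinity>"
      by (rule nn_integral_PInf_AE) (use n_fin in auto)
    ultimately show "AE \<omega> in M. (\<Sum>j. ennreal (?p \<omega> j)) \<le> ennreal \<bar>?L \<omega>\<bar> + (\<Sum>j. ennreal (?n \<omega> j))"
    proof eventually_elim
      case (elim \<omega>)
      have w: "summable (\<lambda>j. Z j \<omega> powr \<alpha>)" using elim(1) by (intro summable_suminf_not_top) auto
      have n: "summable (?n \<omega>)" using elim(2) by (intro summable_suminf_not_top) auto
      have "\<forall>\<^sub>F j in sequentially. Z j \<omega> powr \<alpha> < 1"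
        using summable_LIMSEQ_zero[OF w] by (rule order_tendstoD) simp
      then obtain k where k: "\<And>j. k \<le> j \<Longrightarrow> Z j \<omega> powr \<alpha> < 1" by (auto simp: eventually_sequentially)
      have "?p \<omega> j = 0" if "k \<le> j" for j
      proof -
        have "Z j \<omega> < 1"
          using k[OF that] ge_one_powr_ge_zero[of "Z j \<omega>" \<alpha>] \<alpha>_pos by force
        then have "Z j \<omega> = 0 \<or> ln (Z j \<omega>) \<le> 0"
          using Z_nonneg[of j \<omega>] ln_less_zero[of "Z j \<omega>"] by linarith
        then show ?thesis by auto
      qed
      then have p: "summable (?p \<omega>)" by (intro summable_finite[of "{..<k}"]) auto
      have "?L \<omega> = (\<Sum>j. ?p \<omega> j - ?n \<omega> j)"
        by (intro suminf_cong) (auto simp: max_def algebra_simps)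
      also have "\<dots> = (\<Sum>j. ?p \<omega> j) - (\<Sum>j. ?n \<omega> j)" by (rule suminf_diff[OF p n, symmetric])
      finally have "(\<Sum>j. ?p \<omega> j) \<le> \<bar>?L \<omega>\<bar> + (\<Sum>j. ?n \<omega> j)" by linarith
      then have "ennreal (\<Sum>j. ?p \<omega> j) \<le> ennreal (\<bar>?L \<omega>\<bar> + (\<Sum>j. ?n \<omega> j))" by (rule ennreal_leI)
      also have "\<dots> = ennreal \<bar>?L \<omega>\<bar> + ennreal (\<Sum>j. ?n \<omega> j)"
        by (intro ennreal_plus suminf_nonneg n) auto
      finally show ?case by (simp add: suminf_ennreal2 p n)
    qed
  qed
  also have "\<dots> = (\<integral>\<^sup>+\<omega>. ennreal \<bar>?L \<omega>\<bar> \<partial>M) + (\<integral>\<^sup>+\<omega>. (\<Sum>j. ennreal (?n \<omega> j)) \<partial>M)"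
    by (rule nn_integral_add) auto
  also have "\<dots> < \<infinity>"
    using n_fin log_sum by (auto simp: integrable_iff_bounded)
  finally have p_fin: "(\<integral>\<^sup>+\<omega>. (\<Sum>j. ennreal (?p \<omega> j)) \<partial>M) < \<infinity>" .
  have "integrable tilted (\<lambda>u. max 0 u)"
  proof (rule integrableI_nonneg)
    have "(\<integral>\<^sup>+u. ennreal (max 0 u) \<partial>tilted) = (\<integral>\<^sup>+\<omega>. (\<Sum>j. ennreal (?p \<omega> j)) \<partial>M)"
      by (subst nn_integral_tilted) (simp_all add: ennreal_mult)
    then show "(\<integral>\<^sup>+u. ennreal (max 0 u) \<partial>tilted) < \<infinity>" using p_fin by simp
  qed auto
  from Bochner_Integration.integrable_diff[OF this neg] show ?thesis
    by (rule Bochner_Integration.integrable_cong[THEN iffD1, rotated -1]) (auto simp: max_def)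
qed

lemma tilted_nonarithmetic:
  assumes "countable D"
    and pos: "emeasure M {\<omega> \<in> space M. 0 < Z j \<omega> \<and> ln (Z j \<omega>) \<notin> D} \<noteq> 0"
  shows "emeasure tilted (UNIV - D) \<noteq> 0"
proof
  have D [measurable]: "D \<in> sets borel" by (rule sets.countable) (use assms in auto)
  assume "emeasure tilted (UNIV - D) = 0"
  then have "(\<integral>\<^sup>+u. indicator (UNIV - D) u \<partial>tilted) = 0" using D by (subst nn_integral_indicator) auto
  then have "(\<integral>\<^sup>+\<omega>. (\<Sum>j. ennreal (Z j \<omega> powr \<alpha>) * indicator (UNIV - D) (ln (Z j \<omega>))) \<partial>M) = 0"
    by (subst (asm) nn_integral_tilted) auto
  then have "AE \<omega> in M. (\<Sum>j. ennreal (Z j \<omega> powr \<alpha>) * indicator (UNIV - D) (ln (Z j \<omega>))) = 0"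
    by (subst (asm) nn_integral_0_iff_AE) auto
  then have "AE \<omega> in M. \<not> (0 < Z j \<omega> \<and> ln (Z j \<omega>) \<notin> D)"
  proof eventually_elim
    case (elim \<omega>)
    then have "ennreal (Z j \<omega> powr \<alpha>) * indicator (UNIV - D) (ln (Z j \<omega>)) = 0"
      by (subst (asm) suminf_eq_zero_iff) auto
    then show ?case by (auto split: split_indicator_asm)
  qed
  then have "emeasure M {\<omega> \<in> space M. 0 < Z j \<omega> \<and> ln (Z j \<omega>) \<notin> D} = 0"
    by (subst (asm) AE_iff_measurable[OF _ refl]) auto
  with pos show False by simp
qed

end

section \<open>The tail equation\<close>

locale weighted_tail = weight_sequence +
  fixes R :: "'a \<Rightarrow> real"
  assumes R_measurable [measurable]: "R \<in> borel_measurable M"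
    and indep: "\<And>j. indep_var borel R borel (Z j)"
begin

definition tail :: "real \<Rightarrow> real" where
  "tail x = measure M {\<omega> \<in> space M. x < R \<omega>}"

definition exceedances :: "real \<Rightarrow> ennreal" where
  "exceedances x = (\<integral>\<^sup>+\<omega>. (\<Sum>j. indicator {x<..} (Z j \<omega> * R \<omega>)) \<partial>M)"

lemma tail_antimono: "x \<le> y \<Longrightarrow> tail y \<le> tail x"
  unfolding tail_def by (intro finite_measure_mono) auto

lemma tail_nonneg: "0 \<le> tail x"
  by (simp add: tail_def)

lemma measurable_tail [measurable]: "tail \<in> borel_measurable borel"
proof -
  have "(\<lambda>x. - tail x) \<in> borel_measurable borel"
    by (rule borel_measurable_mono) (auto simp: mono_def tail_antimono)
  then have "(\<lambda>x. - (- tail x)) \<in> borel_measurable borel" by (rule borel_measurable_uminus)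
  then show ?thesis by simp
qed

text \<open>
Conditioning on the weight, by Fubini's theorem for the product distribution of \<open>(R, Z j)\<close>.
\<close>

lemma emeasure_product_exceeds:
  assumes "0 < x"
  shows "emeasure M {\<omega> \<in> space M. x < Z j \<omega> * R \<omega>}
    = (\<integral>\<^sup>+\<omega>. (if 0 < Z j \<omega> then ennreal (tail (x / Z j \<omega>)) else 0) \<partial>M)"
proof -
  let ?A = "{p. x < snd p * fst p} :: (real \<times> real) set"
  have "{p \<in> space (borel \<Otimes>\<^sub>M borel). x < snd p * fst p} \<in> sets (borel \<Otimes>\<^sub>M (borel :: real measure))"
    by measurable
  then have A [measurable]: "?A \<in> sets (borel \<Otimes>\<^sub>M borel)" by (simp add: space_pair_measure)
  interpret DR: prob_space "distr M borel R" by (rule prob_space_distr) simp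
  interpret DZ: prob_space "distr M borel (Z j)" by (rule prob_space_distr) simp
  interpret P: pair_sigma_finite "distr M borel R" "distr M borel (Z j)"
    by (intro pair_sigma_finite.intro DR.sigma_finite_measure_axioms DZ.sigma_finite_measure_axioms)
  have "sets (distr M borel R \<Otimes>\<^sub>M distr M borel (Z j)) = sets (borel \<Otimes>\<^sub>M borel)"
    by (rule sets_pair_measure_cong) simp_all
  with A have A': "?A \<in> sets (distr M borel R \<Otimes>\<^sub>M distr M borel (Z j))" by (simp only:)
  have "emeasure M {\<omega> \<in> space M. x < Z j \<omega> * R \<omega>}
      = emeasure (distr M (borel \<Otimes>\<^sub>M borel) (\<lambda>\<omega>. (R \<omega>, Z j \<omega>))) ?A"
    by (subst emeasure_distr) (auto intro!: arg_cong[where f="emeasure M"] simp: space_pair_measure)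
  also have "distr M (borel \<Otimes>\<^sub>M borel) (\<lambda>\<omega>. (R \<omega>, Z j \<omega>)) = distr M borel R \<Otimes>\<^sub>M distr M borel (Z j)"
    using indep[of j] by (simp add: indep_var_distribution_eq)
  also have "emeasure \<dots> ?A = (\<integral>\<^sup>+z. emeasure (distr M borel R) ((\<lambda>y. (y, z)) -` ?A) \<partial>distr M borel (Z j))"
    by (rule P.emeasure_pair_measure_alt2[OF A'])
  also have "\<dots> = (\<integral>\<^sup>+\<omega>. emeasure (distr M borel R) ((\<lambda>y. (y, Z j \<omega>)) -` ?A) \<partial>M)"
  proof (rule nn_integral_distr)
    show "(\<lambda>z. emeasure (distr M borel R) ((\<lambda>y. (y, z)) -` ?A)) \<in> borel_measurable (distr M borel (Z j))"
      by (rule P.measurable_emeasure_Pair2[OF A'])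
  qed simp
  also have "\<dots> = (\<integral>\<^sup>+\<omega>. (if 0 < Z j \<omega> then ennreal (tail (x / Z j \<omega>)) else 0) \<partial>M)"
  proof (rule nn_integral_cong)
    fix \<omega>
    have vim: "(\<lambda>y. (y, Z j \<omega>)) -` ?A = {y. x < Z j \<omega> * y}" by (auto simp: space_pair_measure)
    show "emeasure (distr M borel R) ((\<lambda>y. (y, Z j \<omega>)) -` ?A)
      = (if 0 < Z j \<omega> then ennreal (tail (x / Z j \<omega>)) else 0)"
    proof (cases "0 < Z j \<omega>")
      case True
      then have "{y. x < Z j \<omega> * y} = {x / Z j \<omega><..}" by (auto simp: field_simps)
      moreover have "R -` {x / Z j \<omega><..} \<inter> space M = {\<omega>' \<in> space M. x / Z j \<omega> < R \<omega>'}" by auto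
      ultimately show ?thesis using True
        by (simp add: vim emeasure_distr tail_def emeasure_eq_measure)
    next
      case False
      then have "{y. x < Z j \<omega> * y} = {}" using Z_nonneg[of j \<omega>] \<open>0 < x\<close> by auto
      then show ?thesis using False by (simp add: vim)
    qed
  qed
  finally show ?thesis .
qed

text \<open>
The factor \<open>Z\<^sub>j\<^sup>\<alpha>\<close> of the tilted measure cancels against \<open>exp (\<alpha> (t - ln Z\<^sub>j))\<close>; this is what turns the
multiplicative comparison of tails into a convolution.
\<close>

lemma tilted_backward_tail:
  "(\<integral>\<^sup>+u. ennreal (exp (\<alpha> * (t - u)) * tail (exp (t - u))) \<partial>tilted) = ennreal (exp (\<alpha> * t)) * exceedances (exp t)"
proof -
  have "ennreal (Z j \<omega> powr \<alpha>) * ennreal (exp (\<alpha> * (t - ln (Z j \<omega>))) * tail (exp (t - ln (Z j \<omega>))))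
      = ennreal (exp (\<alpha> * t)) * (if 0 < Z j \<omega> then ennreal (tail (exp t / Z j \<omega>)) else 0)" for j \<omega>
  proof (cases "0 < Z j \<omega>")
    case True
    have "Z j \<omega> powr \<alpha> * (exp (\<alpha> * (t - ln (Z j \<omega>))) * tail (exp (t - ln (Z j \<omega>))))
      = exp (\<alpha> * t) * tail (exp t / Z j \<omega>)"
      using True by (simp add: powr_def exp_diff right_diff_distrib)
    then show ?thesis using True tail_nonneg by (simp add: ennreal_mult[symmetric])
  qed (use Z_nonneg[of j \<omega>] in simp)
  then have "(\<integral>\<^sup>+u. ennreal (exp (\<alpha> * (t - u)) * tail (exp (t - u))) \<partial>tilted)
      = (\<integral>\<^sup>+\<omega>. (\<Sum>j. ennreal (exp (\<alpha> * t)) * (if 0 < Z j \<omega> then ennreal (tail (exp t / Z j \<omega>)) else 0)) \<partial>M)"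
    by (simp add: nn_integral_tilted)
  also have "\<dots> = (\<Sum>j. ennreal (exp (\<alpha> * t)) * emeasure M {\<omega> \<in> space M. exp t < Z j \<omega> * R \<omega>})"
    by (subst nn_integral_suminf) (simp_all add: nn_integral_cmult emeasure_product_exceeds)
  also have "\<dots> = ennreal (exp (\<alpha> * t)) * (\<Sum>j. emeasure M {\<omega> \<in> space M. exp t < Z j \<omega> * R \<omega>})"
    by (rule ennreal_suminf_cmult)
  also have "(\<Sum>j. emeasure M {\<omega> \<in> space M. exp t < Z j \<omega> * R \<omega>}) = exceedances (exp t)"
  proof -
    have "emeasure M {\<omega> \<in> space M. exp t < Z j \<omega> * R \<omega>} = (\<integral>\<^sup>+\<omega>. indicator {exp t<..} (Z j \<omega> * R \<omega>) \<partial>M)" for j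
      by (subst nn_integral_indicator[symmetric], simp, intro nn_integral_cong) (auto split: split_indicator)
    then show ?thesis by (simp add: exceedances_def nn_integral_suminf)
  qed
  finally show ?thesis .
qed

end

context weighted_tail
begin

text \<open>
The function \<open>r(t) = e\<^bsup>\<alpha>t\<^esup> P(R > e\<^sup>t)\<close> satisfies the hypotheses of the renewal theorem: its growth bound is
the monotonicity of the tail, and its exponential bound is Markov's inequality for the moment of
order \<open>\<alpha> - \<kappa>\<close>, where \<open>\<kappa>\<close> is so small that the tilted Laplace transform is below \<open>1\<close>.
\<close>

theorem tail_asymptotics:
  fixes \<kappa>\<^sub>0 :: real
  defines "m \<equiv> \<integral>\<omega>. (\<Sum>j. Z j \<omega> powr \<alpha> * ln (Z j \<omega>)) \<partial>M"
  defines "h \<equiv> \<lambda>v. v powr (\<alpha> - 1) * (tail v - enn2real (exceedances v))"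
  assumes \<kappa>\<^sub>0: "0 < \<kappa>\<^sub>0" "\<kappa>\<^sub>0 \<le> \<alpha>" "(\<integral>\<^sup>+\<omega>. (\<Sum>j. ennreal (Z j \<omega> powr (\<alpha> - \<kappa>\<^sub>0))) \<partial>M) < \<infinity>"
    and log_sum: "integrable M (\<lambda>\<omega>. \<Sum>j. Z j \<omega> powr \<alpha> * ln (Z j \<omega>))" "0 < m"
    and nonarith: "\<And>d. 0 < d \<Longrightarrow>
      emeasure M {\<omega> \<in> space M. 0 < Z j \<omega> \<and> ln (Z j \<omega>) \<notin> range (\<lambda>k::int. d * of_int k)} \<noteq> 0"
    and R_moments: "\<And>\<beta>. 0 < \<beta> \<Longrightarrow> \<beta> < \<alpha> \<Longrightarrow> (\<integral>\<^sup>+\<omega>. ennreal (R \<omega> powr \<beta>) \<partial>M) < \<infinity>"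
    and h_fin: "(\<integral>\<^sup>+v. ennreal \<bar>h v\<bar> * indicator {0<..} v \<partial>lborel) < \<infinity>"
  shows "((\<lambda>x. x powr \<alpha> * tail x) \<longlongrightarrow> (LINT v:{0<..}|lborel. h v) / m) at_top"
proof -
  have step: "integrable tilted (\<lambda>u. u)"
    by (rule tilted_step_integrable[OF \<kappa>\<^sub>0(1,3) log_sum(1)])
  have mean: "(\<integral>u. u \<partial>tilted) = m" unfolding m_def by (rule integral_tilted(2)[OF step])
  have pos: "0 < (\<integral>u. u \<partial>tilted)" using mean log_sum(2) by simp
  from T.exists_exponential_moment_less_1[OF step pos \<kappa>\<^sub>0(1) tilted_exp_integrable[OF \<kappa>\<^sub>0(3)]]
  obtain \<kappa> where \<kappa>: "0 < \<kappa>" "\<kappa> < \<kappa>\<^sub>0" "integrable tilted (\<lambda>u. exp (- \<kappa> * u))" "(\<integral>u. exp (- \<kappa> * u) \<partial>tilted) < 1"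
    by blast
  define r where "r t = exp (\<alpha> * t) * tail (exp t)" for t
  define g where "g t = exp (\<alpha> * t) * (tail (exp t) - enn2real (exceedances (exp t)))" for t
  define \<beta> where "\<beta> = \<alpha> - \<kappa>"
  have \<beta>: "0 < \<beta>" "\<beta> < \<alpha>" using \<kappa>(1,2) \<kappa>\<^sub>0(2) by (auto simp: \<beta>_def)
  define c where "c = enn2real (\<integral>\<^sup>+\<omega>. ennreal (R \<omega> powr \<beta>) \<partial>M)"
  have c: "(\<integral>\<^sup>+\<omega>. ennreal (R \<omega> powr \<beta>) \<partial>M) = ennreal c"
    using R_moments[OF \<beta>] by (simp add: c_def)
  have [measurable]: "r \<in> borel_measurable borel" unfolding r_def by measurable
  have r_bound: "r t \<le> c * exp (\<kappa> * t)" for t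
  proof -
    have "ennreal (exp t powr \<beta>) * emeasure M {\<omega> \<in> space M. exp t < R \<omega>}
        = (\<integral>\<^sup>+\<omega>. ennreal (exp t powr \<beta>) * indicator {\<omega> \<in> space M. exp t < R \<omega>} \<omega> \<partial>M)"
      by (subst nn_integral_cmult_indicator) auto
    also have "\<dots> \<le> (\<integral>\<^sup>+\<omega>. ennreal (R \<omega> powr \<beta>) \<partial>M)"
    proof (rule nn_integral_mono)
      fix \<omega>
      show "ennreal (exp t powr \<beta>) * indicator {\<omega> \<in> space M. exp t < R \<omega>} \<omega> \<le> ennreal (R \<omega> powr \<beta>)"
        using \<beta>(1) by (auto split: split_indicator intro!: ennreal_leI powr_mono2)
    qed
    also have "ennreal (exp t powr \<beta>) * emeasure M {\<omega> \<in> space M. exp t < R \<omega>}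
        = ennreal (exp (\<beta> * t) * tail (exp t))"
      by (simp add: emeasure_eq_measure tail_def[symmetric] ennreal_mult tail_nonneg powr_def)
    finally have "ennreal (exp (\<beta> * t) * tail (exp t)) \<le> ennreal c" unfolding c .
    then have "exp (\<beta> * t) * tail (exp t) \<le> c"
      by (subst (asm) ennreal_le_iff) (auto simp: c_def)
    then have "exp (\<kappa> * t) * (exp (\<beta> * t) * tail (exp t)) \<le> exp (\<kappa> * t) * c" by (rule mult_left_mono) simp
    moreover have "exp (\<kappa> * t) * exp (\<beta> * t) = exp (\<alpha> * t)"
      by (simp add: exp_add[symmetric] \<beta>_def algebra_simps mult_exp_exp)
    then have "exp (\<kappa> * t) * (exp (\<beta> * t) * tail (exp t)) = r t"
      by (simp only: r_def mult.assoc[symmetric])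
    ultimately show ?thesis by (simp only: mult.commute[of c])
  qed
  have equation: "(\<integral>u. r (t - u) \<partial>tilted) = exp (\<alpha> * t) * enn2real (exceedances (exp t))" for t
  proof -
    have "(\<integral>u. r (t - u) \<partial>tilted) = enn2real (\<integral>\<^sup>+u. ennreal (r (t - u)) \<partial>tilted)"
      by (rule integral_eq_nn_integral) (auto simp: r_def tail_nonneg)
    also have "\<dots> = exp (\<alpha> * t) * enn2real (exceedances (exp t))"
      unfolding r_def tilted_backward_tail by (simp add: enn2real_mult)
    finally show ?thesis .
  qed
  then have g_eq: "g = (\<lambda>t. r t - T.shift_mean r t)"
    by (auto simp: g_def r_def T.shift_mean_def right_diff_distrib)
  have [measurable]: "g \<in> borel_measurable borel" unfolding g_eq by measurable
  have h_eq: "g (ln v) / v = h v" if "0 < v" for v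
    using that by (simp add: g_def h_def powr_def exp_diff left_diff_distrib)
  have "set_integrable lborel {0<..} (\<lambda>v. g (ln v) / v)"
    unfolding set_integrable_def
  proof (rule integrableI_bounded)
    have "(\<integral>\<^sup>+v. ennreal (norm (indicator {0<..} v *\<^sub>R (g (ln v) / v))) \<partial>lborel)
        = (\<integral>\<^sup>+v. ennreal \<bar>h v\<bar> * indicator {0<..} v \<partial>lborel)"
      by (intro nn_integral_cong) (auto simp: h_eq[symmetric] split: split_indicator)
    then show "(\<integral>\<^sup>+v. ennreal (norm (indicator {0<..} v *\<^sub>R (g (ln v) / v))) \<partial>lborel) < \<infinity>"
      using h_fin by simp
  qed measurable
  note subst = integral_exp_substitution[OF _ this]
  have g_int: "integrable lborel g" and g_integral: "(LINT v:{0<..}|lborel. h v) = (\<integral>t. g t \<partial>lborel)"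
  proof -
    show "integrable lborel g" by (rule subst) measurable
    have "(LINT v:{0<..}|lborel. h v) = (LINT v:{0<..}|lborel. g (ln v) / v)"
      by (rule set_lebesgue_integral_cong) (auto simp: h_eq)
    also have "\<dots> = (\<integral>t. g t \<partial>lborel)" by (rule subst) measurable
    finally show "(LINT v:{0<..}|lborel. h v) = (\<integral>t. g t \<partial>lborel)" .
  qed
  interpret A: additive_renewal tilted \<kappa> "\<integral>u. exp (- \<kappa> * u) \<partial>tilted" r g \<alpha> c
  proof
    show "0 \<le> r t" for t by (simp add: r_def tail_nonneg)
    show "r (t + s) \<le> exp (\<alpha> * s) * r t" if "0 \<le> s" for s t
    proof -
      have "tail (exp (t + s)) \<le> tail (exp t)" using that by (intro tail_antimono) simp
      then have "exp (\<alpha> * (t + s)) * tail (exp (t + s)) \<le> exp (\<alpha> * (t + s)) * tail (exp t)"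
        by (rule mult_left_mono) simp
      then show ?thesis by (simp add: r_def exp_add distrib_left algebra_simps)
    qed
    show "r t = g t + (\<integral>u. r (t - u) \<partial>tilted)" for t
      unfolding equation by (simp add: g_def r_def right_diff_distrib)
    show "emeasure tilted (UNIV - range (\<lambda>k::int. d * of_int k)) \<noteq> 0" if "0 < d" for d
      by (rule tilted_nonarithmetic[OF _ nonarith[OF that]]) simp
    show "0 \<le> \<alpha>" using \<alpha>_pos by simp
  qed (rule \<kappa> refl r_bound g_int step \<open>r \<in> borel_measurable borel\<close>)+
  have "(r \<longlongrightarrow> (LINT v:{0<..}|lborel. h v) / m) at_top"
    using A.renewal_limit[OF pos[THEN less_imp_neq, symmetric]] unfolding mean g_integral .
  then have "((\<lambda>x. r (ln x)) \<longlongrightarrow> (LINT v:{0<..}|lborel. h v) / m) at_top"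
    by (rule filterlim_compose[OF _ ln_at_top])
  then show ?thesis
  proof (rule Lim_transform_eventually)
    show "\<forall>\<^sub>F x in at_top. r (ln x) = x powr \<alpha> * tail x"
      using eventually_gt_at_top[of "0::real"] by eventually_elim (simp add: r_def powr_def)
  qed
qed

end

section \<open>Random numbers of weights\<close>

text \<open>
Absorbing the cutoff at \<open>N\<close> into the weights removes \<open>N\<close> from the problem, since a weight \<open>0\<close> adds nothing
to any of the sums.  The maximum with \<open>0\<close> repairs the null set on which a weight may be negative.
\<close>

definition capped_weight :: "('a \<Rightarrow> enat) \<Rightarrow> (nat \<Rightarrow> 'a \<Rightarrow> real) \<Rightarrow> nat \<Rightarrow> 'a \<Rightarrow> real" where
  "capped_weight N C j \<omega> = (if j \<in> branches (N \<omega>) then max 0 (C j \<omega>) else 0)"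

text \<open>
A random variable that factors through \<open>F\<close> generates a smaller sigma algebra than \<open>F\<close>, so it inherits
the independence of \<open>F\<close>.
\<close>

lemma sets_vimage_algebra_comp:
  assumes F: "F \<in> space M \<rightarrow> space K" and H: "H \<in> measurable K L"
  shows "sigma_sets (space M) {(\<lambda>\<omega>. H (F \<omega>)) -` A \<inter> space M |A. A \<in> sets L}
    \<subseteq> sets (vimage_algebra (space M) F K)"
proof -
  have "(\<lambda>\<omega>. H (F \<omega>)) -` A \<inter> space M \<in> sets (vimage_algebra (space M) F K)" if "A \<in> sets L" for A
  proof -
    have "(\<lambda>\<omega>. H (F \<omega>)) -` A \<inter> space M = F -` (H -` A \<inter> space K) \<inter> space M" using F by auto
    then show ?thesis by (simp only: in_vimage_algebra[OF measurable_sets[OF H that]])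
  qed
  then have "{(\<lambda>\<omega>. H (F \<omega>)) -` A \<inter> space M |A. A \<in> sets L} \<subseteq> sets (vimage_algebra (space M) F K)" by blast
  from sets.sigma_sets_subset[OF this] show ?thesis by simp
qed

lemma (in prob_space) indep_var_capped_weight:
  assumes N: "N \<in> measurable M (count_space UNIV)"
    and C: "\<And>j. j \<ge> 1 \<Longrightarrow> C j \<in> borel_measurable M"
    and R: "R \<in> borel_measurable M"
    and indep: "indep_set (sets (vimage_algebra (space M) R borel))
      (sets (vimage_algebra (space M) (\<lambda>\<omega>. (N \<omega>, \<lambda>j\<in>{1..}. C j \<omega>))
        (count_space UNIV \<Otimes>\<^sub>M (\<Pi>\<^sub>M j\<in>{1..}. borel))))"
  shows "indep_var borel R borel (capped_weight N C j)"
proof -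
  let ?K = "count_space (UNIV :: enat set) \<Otimes>\<^sub>M (\<Pi>\<^sub>M j\<in>{1..}. (borel :: real measure))"
  let ?F = "\<lambda>\<omega>. (N \<omega>, \<lambda>j\<in>{1..}. C j \<omega>)"
  let ?H = "\<lambda>(n, c). if 1 \<le> j \<and> enat j \<le> n then max 0 (c j) else (0 :: real)"
  have H: "?H \<in> borel_measurable ?K"
  proof (cases "1 \<le> j")
    case True
    then have [measurable]: "(\<lambda>p. snd p j) \<in> borel_measurable ?K"
      by (intro measurable_compose[OF measurable_snd] measurable_component_singleton) auto
    have [measurable]: "Measurable.pred ?K (\<lambda>p. enat j \<le> fst p)"
      by (rule measurable_compose[OF measurable_fst]) simp
    show ?thesis unfolding case_prod_beta by measurable
  qed simp
  have F: "?F \<in> space M \<rightarrow> space ?K" by (auto simp: space_pair_measure space_PiM)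
  have eq: "capped_weight N C j = (\<lambda>\<omega>. ?H (?F \<omega>))"
    by (auto simp: capped_weight_def branches_def fun_eq_iff)
  have FM: "?F \<in> measurable M ?K"
    using N C by (intro measurable_Pair measurable_restrict) auto
  have rv: "random_variable borel (capped_weight N C j)"
    unfolding eq by (rule measurable_compose[OF FM H])
  have "indep_set (sigma_sets (space M) {R -` A \<inter> space M |A. A \<in> sets borel})
      (sigma_sets (space M) {capped_weight N C j -` A \<inter> space M |A. A \<in> sets borel})"
    using indep sets_vimage_algebra_comp[OF F H] unfolding indep_set_def eq sets_vimage_algebra
    by (elim indep_sets_mono_sets) (auto split: bool.split)
  then show ?thesis using R rv by (simp add: indep_var_eq)
qed

text \<open>
The capped weights have the moments, the logarithmic sum and the expected exceedances of the
original ones, so the tail asymptotics for them apply; the limit \<open>H\<close> is nonnegative as a limit of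
nonnegative quantities.
\<close>

theorem theorem3p1:
  fixes M :: "'a measure"
    and N :: "'a \<Rightarrow> enat"
    and C :: "nat \<Rightarrow> 'a \<Rightarrow> real"
    and R :: "'a \<Rightarrow> real"
    and \<alpha> H :: real
  assumes "prob_space M"
    and "N \<in> measurable M (count_space UNIV)"
    and "\<And>j. j \<ge> 1 \<Longrightarrow> C j \<in> borel_measurable M"
    and "\<And>j. j \<ge> 1 \<Longrightarrow> AE \<omega> in M. C j \<omega> \<ge> 0"
    and "R \<in> borel_measurable M"
    and "AE \<omega> in M. R \<omega> \<ge> 0"
    and "\<alpha> > 0"
    and "\<exists>j\<ge>1. measure M {\<omega> \<in> space M. N \<omega> \<ge> enat j \<and> C j \<omega> > 0} > 0
            \<and> nonarithmetic (log_weight_measure M N C j)"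
    and "integrable M (log_weight_sum N C \<alpha>)"
    and "0 < (\<integral>\<omega>. log_weight_sum N C \<alpha> \<omega> \<partial>M)"
    and "weight_moment M N C \<alpha> = 1"
    and "\<exists>\<gamma>. 0 \<le> \<gamma> \<and> \<gamma> < \<alpha> \<and> weight_moment M N C \<gamma> < \<infinity>"
    and "prob_space.indep_set M
           (sets (vimage_algebra (space M) R borel))
           (sets (vimage_algebra (space M) (\<lambda>\<omega>. (N \<omega>, \<lambda>j\<in>{1..}. C j \<omega>))
              (count_space UNIV \<Otimes>\<^sub>M (\<Pi>\<^sub>M j\<in>{1..}. borel))))"
    and "\<And>\<beta>. 0 < \<beta> \<Longrightarrow> \<beta> < \<alpha> \<Longrightarrow> (\<integral>\<^sup>+\<omega>. ennreal (R \<omega> powr \<beta>) \<partial>M) < \<infinity>"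
    and "(\<integral>\<^sup>+t\<in>{0<..}. ennreal (\<bar>measure M {\<omega> \<in> space M. R \<omega> > t} - expected_exceedances M N C R t\<bar>
            * t powr (\<alpha> - 1)) \<partial>lborel) < \<infinity>"
    and "H = 1 / (\<integral>\<omega>. log_weight_sum N C \<alpha> \<omega> \<partial>M)
           * (LINT v:{0<..}|lborel. v powr (\<alpha> - 1)
                * (measure M {\<omega> \<in> space M. R \<omega> > v} - expected_exceedances M N C R v))"
  shows "0 \<le> H
    \<and> (H > 0 \<longrightarrow> (\<lambda>t. measure M {\<omega> \<in> space M. R \<omega> > t}) \<sim>[at_top] (\<lambda>t. H * t powr (- \<alpha>)))
    \<and> (H = 0 \<longrightarrow> (\<lambda>t. measure M {\<omega> \<in> space M. R \<omega> > t}) \<in> o[at_top](\<lambda>t. t powr (- \<alpha>)))"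
proof -
  interpret prob_space M by fact
  note [measurable] = assms(2) assms(5)
  let ?Z = "capped_weight N C"
  have Z_meas [measurable]: "?Z j \<in> borel_measurable M" for j
    using indep_var_rv2[OF indep_var_capped_weight[OF assms(2,3,5,13)]] .
  have "AE \<omega> in M. \<forall>j\<in>{1..}. 0 \<le> C j \<omega>"
    using assms(4) by (subst AE_ball_countable) auto
  then have Z_eq: "AE \<omega> in M. \<forall>j. ?Z j \<omega> = C j \<omega> * indicator (branches (N \<omega>)) j"
    by eventually_elim (auto simp: capped_weight_def branches_def split: split_indicator)
  have moment: "(\<integral>\<^sup>+\<omega>. (\<Sum>j. ennreal (?Z j \<omega> powr s)) \<partial>M) = weight_moment M N C s" for s
    unfolding weight_moment_def
  proof (rule nn_integral_cong_AE)
    show "AE \<omega> in M. (\<Sum>j. ennreal (?Z j \<omega> powr s))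
        = (\<Sum>j. ennreal (C j \<omega> powr s) * indicator (branches (N \<omega>)) j)"
      using Z_eq by eventually_elim (auto intro!: arg_cong[where f=suminf] split: split_indicator)
  qed
  have log_sum_eq: "AE \<omega> in M. log_weight_sum N C \<alpha> \<omega> = (\<Sum>j. ?Z j \<omega> powr \<alpha> * ln (?Z j \<omega>))"
    using Z_eq unfolding log_weight_sum_def
    by eventually_elim (auto intro!: arg_cong[where f=suminf] split: split_indicator)
  have [measurable]: "log_weight_sum N C \<alpha> \<in> borel_measurable M"
    using assms(9) by (rule borel_measurable_integrable)
  interpret W: weighted_tail M ?Z \<alpha> R
  proof
    show "0 \<le> ?Z j \<omega>" for j \<omega> by (simp add: capped_weight_def)
    show "(\<integral>\<^sup>+\<omega>. (\<Sum>j. ennreal (?Z j \<omega> powr \<alpha>)) \<partial>M) = 1" by (simp only: moment assms(11))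
    show "indep_var borel R borel (?Z j)" for j by (rule indep_var_capped_weight[OF assms(2,3,5,13)])
  qed (use assms(7) in simp_all)
  have tail: "measure M {\<omega> \<in> space M. R \<omega> > x} = W.tail x" for x by (simp add: W.tail_def)
  have exceed: "expected_exceedances M N C R x = enn2real (W.exceedances x)" if "0 < x" for x
    unfolding expected_exceedances_def W.exceedances_def
  proof (rule arg_cong[where f=enn2real], rule nn_integral_cong_AE)
    show "AE \<omega> in M. (\<Sum>j. indicator {x<..} (C j \<omega> * R \<omega>) * indicator (branches (N \<omega>)) j)
        = (\<Sum>j. indicator {x<..} (?Z j \<omega> * R \<omega>) :: ennreal)"
      using Z_eq by eventually_elim (use that in \<open>auto intro!: arg_cong[where f=suminf] split: split_indicator\<close>)
  qed
  define m where "m = (\<integral>\<omega>. log_weight_sum N C \<alpha> \<omega> \<partial>M)"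
  have m_eq: "m = (\<integral>\<omega>. (\<Sum>j. ?Z j \<omega> powr \<alpha> * ln (?Z j \<omega>)) \<partial>M)"
    unfolding m_def by (rule integral_cong_AE) (use log_sum_eq in auto)
  obtain \<gamma> where \<gamma>: "0 \<le> \<gamma>" "\<gamma> < \<alpha>" "weight_moment M N C \<gamma> < \<infinity>" using assms(12) by blast
  obtain j where j: "1 \<le> j" "nonarithmetic (log_weight_measure M N C j)" using assms(8) by blast
  have [measurable]: "C j \<in> borel_measurable M" using assms(3)[OF j(1)] .
  have nonarith: "emeasure M {\<omega> \<in> space M. 0 < ?Z j \<omega> \<and> ln (?Z j \<omega>) \<notin> range (\<lambda>k::int. d * of_int k)} \<noteq> 0"
    if "0 < d" for d
  proof -
    define D where "D = range (\<lambda>k::int. d * of_int k)"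
    let ?S = "{\<omega> \<in> space M. C j \<omega> > 0 \<and> N \<omega> \<ge> enat j}"
    have [measurable]: "D \<in> sets borel" unfolding D_def by (rule sets.countable) auto
    have [measurable]: "Measurable.pred M (\<lambda>\<omega>. enat j \<le> N \<omega>)"
      by (rule measurable_compose[OF assms(2)]) simp
    have S: "?S \<in> sets M" by measurable
    have "0 \<noteq> emeasure (log_weight_measure M N C j) (UNIV - D)"
      using j(2) that unfolding nonarithmetic_def D_def by metis
    also have "emeasure (log_weight_measure M N C j) (UNIV - D)
        = emeasure (restrict_space M ?S) ((\<lambda>\<omega>. ln (C j \<omega>)) -` (UNIV - D) \<inter> space (restrict_space M ?S))"
      unfolding log_weight_measure_def by (rule emeasure_distr) (auto intro: measurable_restrict_space1)
    also have "\<dots> = emeasure M ((\<lambda>\<omega>. ln (C j \<omega>)) -` (UNIV - D) \<inter> space (restrict_space M ?S))"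
      using S by (intro emeasure_restrict_space) (auto simp: space_restrict_space)
    also have "(\<lambda>\<omega>. ln (C j \<omega>)) -` (UNIV - D) \<inter> space (restrict_space M ?S)
        = {\<omega> \<in> space M. 0 < ?Z j \<omega> \<and> ln (?Z j \<omega>) \<notin> D}"
      using j(1) by (auto simp: space_restrict_space capped_weight_def branches_def max_def split: if_splits)
    finally show ?thesis by (simp add: D_def)
  qed
  define L where "L = (LINT v:{0<..}|lborel. v powr (\<alpha> - 1) * (W.tail v - enn2real (W.exceedances v)))"
  have lim: "((\<lambda>x. x powr \<alpha> * W.tail x) \<longlongrightarrow> L / m) at_top"
    unfolding L_def m_eq
  proof (rule W.tail_asymptotics[of "\<alpha> - \<gamma>"])
    show "(\<integral>\<^sup>+\<omega>. (\<Sum>j. ennreal (?Z j \<omega> powr (\<alpha> - (\<alpha> - \<gamma>)))) \<partial>M) < \<infinity>"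
      using \<gamma>(3) moment[of \<gamma>] by simp
    show "integrable M (\<lambda>\<omega>. \<Sum>j. ?Z j \<omega> powr \<alpha> * ln (?Z j \<omega>))"
      using assms(9) by (rule integrable_cong_AE_imp) (use log_sum_eq in \<open>auto simp: eq_commute\<close>)
    show "0 < (\<integral>\<omega>. (\<Sum>j. ?Z j \<omega> powr \<alpha> * ln (?Z j \<omega>)) \<partial>M)"
      using assms(10) m_eq m_def by simp
    show "(\<integral>\<^sup>+v. ennreal \<bar>v powr (\<alpha> - 1) * (W.tail v - enn2real (W.exceedances v))\<bar> * indicator {0<..} v \<partial>lborel) < \<infinity>"
      by (rule le_less_trans[OF eq_refl assms(15)], rule nn_integral_cong)
         (auto simp: tail exceed abs_mult mult.commute split: split_indicator)
  qed (use \<gamma> nonarith assms(14) in auto)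
  have "H = L / m"
  proof -
    have "(LINT v:{0<..}|lborel. v powr (\<alpha> - 1) * (measure M {\<omega> \<in> space M. R \<omega> > v} - expected_exceedances M N C R v)) = L"
      unfolding L_def by (rule set_lebesgue_integral_cong) (auto simp: tail exceed)
    then show ?thesis by (simp add: assms(16) m_def)
  qed
  with lim have lim: "((\<lambda>x. x powr \<alpha> * W.tail x) \<longlongrightarrow> H) at_top" by simp
  have nonneg: "0 \<le> H"
    by (rule tendsto_lowerbound[OF lim]) (auto intro!: always_eventually mult_nonneg_nonneg W.tail_nonneg)
  have ratio: "((\<lambda>x. W.tail x / x powr (- \<alpha>)) \<longlongrightarrow> H) at_top"
    using lim by (simp add: powr_minus divide_inverse mult.commute)
  have "(\<lambda>x. W.tail x) \<sim>[at_top] (\<lambda>x. H * x powr (- \<alpha>))" if "0 < H"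
  proof (rule asymp_equivI')
    have "((\<lambda>x. W.tail x / x powr (- \<alpha>) / H) \<longlongrightarrow> H / H) at_top"
      using that by (intro tendsto_divide ratio tendsto_const) simp
    then show "((\<lambda>x. W.tail x / (H * x powr (- \<alpha>))) \<longlongrightarrow> 1) at_top"
      using that by (simp add: mult.commute)
  qed
  moreover have "(\<lambda>x. W.tail x) \<in> o[at_top](\<lambda>x. x powr (- \<alpha>))" if "H = 0"
    by (rule smalloI_tendsto) (use ratio that eventually_gt_at_top[of "0::real"] in \<open>auto elim: eventually_mono\<close>)
  ultimately show ?thesis using nonneg by (simp add: tail)
qed

end
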